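(* The characteristic polynomial $f=t^3-t^2+at+b\in\mathbb{Q}[t]$ of a rational point $(K/\mathbb{Q},x)\in T(\mathbb{Q})$ has integer coefficients if and only if $(K/\mathbb{Q},x)$ is $D_0$-integral. For any $D_0$-integral rational point $(K/\mathbb{Q},x)$ on $T$, $$H((K/\mathbb{Q},x),\mathcal{O}(D_0))=H(f)=\sqrt{1-3a}.$$
   Context: Let $C_3=\langle\sigma\rangle$ act on $\mathbb{P}_2=\mathrm{Proj}\,\mathbb{Q}[X,Y,Z]$ by cyclic permutation of the coordinates ($(X,Y,Z)$ corresponds to $Xe+Y\sigma+Z\sigma^2$ in the group algebra). Put $\varepsilon=X+Y+Z$, $\Delta=3XYZ-X^3-Y^3-Z^3$ (divisible by $\varepsilon$), $S=\mathbb{P}_2/C_3$, $\mathcal{G}=\mathbb{P}_2[\Delta^{-1}]$ (the torus of units of augmentation one in the group algebra of $C_3$), $T=\mathcal{G}/C_3\subset S$, a rank-two torus over $\mathbb{Q}$, and $D_0=\{\varepsilon=0\}\subset S$. A rational point $P$ of $S-D_0$ is $D_0$-integral if every element of $\mathbb{Z}[X/\varepsilon,Y/\varepsilon]^{C_3}$ is $\mathbb{Z}$-valued on $P$ (here $Z/\varepsilon=1-X/\varepsilon-Y/\varepsilon$). A $C_3$-algebra $K/\mathbb{Q}$ is a $\mathbb{Q}$-algebra with a $C_3$-action that is $C_3$-equivariantly isomorphic to a cubic abelian number field or to the split algebra $\mathbb{Q}^3$ with $C_3$ acting by Galois automorphisms, resp. cyclic permutation. An element $x\in K$ is normal if its $C_3$-conjugates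 are linearly independent over $\mathbb{Q}$. Rational points of $T$ are in bijection with equivalence classes of pairs $(K/\mathbb{Q},x)$ with $x\in K$ normal of trace one (equivalence: a $C_3$-equivariant $\mathbb{Q}$-algebra isomorphism matching the elements); $(K,x)$ corresponds to the image in $T$ of $\sum_{g\in C_3}g(x)[g^{-1}]\in\mathcal{G}(K)$. The characteristic polynomial of $(K,x)$ is that of $x$ over $\mathbb{Q}$, and $H(f):=\sqrt{1-3a}$. Toric height. Let $\zeta$ be a primitive cube root of unity, $E=\mathbb{Q}(\zeta)$. The characters of $\mathcal{G}_E$ have basis $v_1^\vee,v_2^\vee$ with $\chi^{v_1^\vee}=(X+\zeta Y+\zeta^2Z)/\varepsilon$, $\chi^{v_2^\vee}=(X+\zeta^2Y+\zeta Z)/\varepsilon$; let $v_1,v_2$ be the dual basis and $v_0=-v_1-v_2$. The character lattice $M_E$ of $T_E$ is spanned by $a'=2v_1^\vee-v_2^\vee$ and $b'=2v_2^\vee-v_1^\vee$, and its cocharacter lattice $N_E$ is the dual lattice. The fan of $S_E$ in $N_{E,\mathbb{R}}$ is complete with rays spanned by $v_0,v_1,v_2$, and $D_0$ is the divisor attached to $v_0$. For each place $w$ of $E$ let $|\cdot|_w$ be the normalized absolute value ($q_w^{-\mathrm{ord}_w(\cdot)}$, $q_w$ the residue cardinality, if $w$ is finite; the square of the usual absolute value if $w$ is infinite), and for $P\in T(\mathbb{Q})$ let $\ell_w(P)\in N_{E,\mathbb{R}}$ be determined by $m(\ell_w(P))=-\log|\chi^m(P)|_w$ for all $m\in M_E$.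 Let $\varphi_0:N_{E,\mathbb{R}}\to\mathbb{R}$ be the continuous function, linear on each cone, with $\varphi_0(v_0)=-1$, $\varphi_0(v_1)=\varphi_0(v_2)=0$. Then $H(P,\mathcal{O}(D_0))=\prod_w\exp(-\varphi_0(\ell_w(P)))^{1/2}$, over all places $w$ of $E$. *)

theory Defs
  imports "HOL-Analysis.Analysis" "Jordan_Normal_Form.Char_Poly"
begin

section \<open>Algebras over the rationals with an action of the cyclic group of order three\<close>

definition rat_algebra :: "(rat \<Rightarrow> 'k::comm_ring_1 \<Rightarrow> 'k) \<Rightarrow> bool" where
  "rat_algebra sc \<longleftrightarrow>
     vector_space sc \<and> (\<forall>c x y. sc c (x * y) = sc c x * y)"

definition rat_alg_hom ::
    "(rat \<Rightarrow> 'a::ring_1 \<Rightarrow> 'a) \<Rightarrow> (rat \<Rightarrow> 'b::ring_1 \<Rightarrow> 'b) \<Rightarrow> ('a \<Rightarrow> 'b) \<Rightarrow> bool" where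
  "rat_alg_hom s1 s2 h \<longleftrightarrow>
     Vector_Spaces.linear s1 s2 h \<and> h 1 = 1 \<and> (\<forall>x y. h (x * y) = h x * h y)"

definition rat_alg_Aut :: "(rat \<Rightarrow> 'k::ring_1 \<Rightarrow> 'k) \<Rightarrow> ('k \<Rightarrow> 'k) set" where
  "rat_alg_Aut sc = {\<tau>. rat_alg_hom sc sc \<tau> \<and> bij \<tau>}"

text \<open>A cubic field is Galois over the rationals iff it has three automorphisms, and then it is
  abelian. The map \<open>\<sigma>\<close> is the action of the generator of the cyclic group.\<close>

definition cubic_abelian_field ::
    "(rat \<Rightarrow> 'k::comm_ring_1 \<Rightarrow> 'k) \<Rightarrow> ('k \<Rightarrow> 'k) \<Rightarrow> bool" where
  "cubic_abelian_field sc \<sigma> \<longleftrightarrow>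
     (\<forall>y::'k. y \<noteq> 0 \<longrightarrow> (\<exists>z. y * z = 1)) \<and>
     vector_space.dim sc (UNIV :: 'k set) = 3 \<and>
     card (rat_alg_Aut sc) = 3 \<and>
     rat_alg_Aut sc = {id, \<sigma>, \<sigma> \<circ> \<sigma>}"

text \<open>Multiplication on \<open>rat ^ 3\<close> is componentwise, and the indices are integers modulo 3.
  The two cyclic permutations of the coordinates give isomorphic actions.\<close>

definition split_cubic ::
    "(rat \<Rightarrow> 'k::comm_ring_1 \<Rightarrow> 'k) \<Rightarrow> ('k \<Rightarrow> 'k) \<Rightarrow> bool" where
  "split_cubic sc \<sigma> \<longleftrightarrow>
     (\<exists>\<phi> :: 'k \<Rightarrow> rat ^ 3. rat_alg_hom sc (*s) \<phi> \<and> bij \<phi> \<and>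
        (\<forall>y. \<phi> (\<sigma> y) = (\<chi> i. vec_nth (\<phi> y) (i + 1))))"

definition C3_algebra ::
    "(rat \<Rightarrow> 'k::comm_ring_1 \<Rightarrow> 'k) \<Rightarrow> ('k \<Rightarrow> 'k) \<Rightarrow> bool" where
  "C3_algebra sc \<sigma> \<longleftrightarrow>
     rat_algebra sc \<and> (cubic_abelian_field sc \<sigma> \<or> split_cubic sc \<sigma>)"

definition lin_indep_list ::
    "(rat \<Rightarrow> 'k::comm_ring_1 \<Rightarrow> 'k) \<Rightarrow> 'k list \<Rightarrow> bool" where
  "lin_indep_list sc xs \<longleftrightarrow> distinct xs \<and> \<not> module.dependent sc (set xs)"

definition normal_element ::
    "(rat \<Rightarrow> 'k::comm_ring_1 \<Rightarrow> 'k) \<Rightarrow> ('k \<Rightarrow> 'k) \<Rightarrow> 'k \<Rightarrow> bool" where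
  "normal_element sc \<sigma> x \<longleftrightarrow> lin_indep_list sc [x, \<sigma> x, \<sigma> (\<sigma> x)]"

definition C3_trace :: "('k::comm_ring_1 \<Rightarrow> 'k) \<Rightarrow> 'k \<Rightarrow> 'k" where
  "C3_trace \<sigma> x = x + \<sigma> x + \<sigma> (\<sigma> x)"

text \<open>\<open>A\<close> is the matrix of multiplication by \<open>x\<close> in the ordered basis \<open>bs\<close>.\<close>

definition is_mult_matrix ::
    "(rat \<Rightarrow> 'k::comm_ring_1 \<Rightarrow> 'k) \<Rightarrow> 'k \<Rightarrow> 'k list \<Rightarrow> rat mat \<Rightarrow> bool" where
  "is_mult_matrix sc x bs A \<longleftrightarrow>
     lin_indep_list sc bs \<and> module.span sc (set bs) = UNIV \<and>
     A \<in> carrier_mat (length bs) (length bs) \<and>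
     (\<forall>j < length bs. x * bs ! j = (\<Sum>i < length bs. sc (A $$ (i, j)) (bs ! i)))"

text \<open>The choice of basis does not matter, so the description is unique.\<close>

definition alg_char_poly :: "(rat \<Rightarrow> 'k::comm_ring_1 \<Rightarrow> 'k) \<Rightarrow> 'k \<Rightarrow> rat poly" where
  "alg_char_poly sc x = (THE f. \<exists>bs A. is_mult_matrix sc x bs A \<and> f = char_poly A)"

text \<open>For \<open>f = t\<^sup>3 - t\<^sup>2 + a t + b\<close> this is the square root of \<open>1 - 3 a\<close>.\<close>

definition poly_height :: "rat poly \<Rightarrow> real" where
  "poly_height f = sqrt (1 - 3 * of_rat (coeff f 1))"


section \<open>Rational points of the torus\<close>

text \<open>
  Points of the quotient of the projective plane by cyclic permutation of the coordinates are
  represented by their geometric points: orbits of triples \<open>(X, Y, Z)\<close> of complex coordinates.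
  All points that occur have nonzero coordinate sum, and the representatives are normalised so
  that this sum is one. A function on the quotient is an invariant function on triples.
\<close>

type_synonym triple = "complex \<times> complex \<times> complex"

definition C3_orbit :: "triple \<Rightarrow> triple set" where
  "C3_orbit = (\<lambda>(X, Y, Z). {(X, Y, Z), (Y, Z, X), (Z, X, Y)})"

definition value_at :: "triple set \<Rightarrow> (triple \<Rightarrow> complex) \<Rightarrow> complex" where
  "value_at P F = the_elem (F ` P)"

definition aug :: "triple \<Rightarrow> complex" where
  "aug = (\<lambda>(X, Y, Z). X + Y + Z)"

text \<open>
  The point attached to \<open>(K, x)\<close> is the image of the \<open>K\<close>-point
  \<open>x e + \<sigma>(x) \<sigma>\<^sup>-\<^sup>1 + \<sigma>\<^sup>2(x) \<sigma>\<^sup>-\<^sup>2\<close>, where \<open>\<sigma>\<^sup>-\<^sup>1 = \<sigma>\<^sup>2\<close>; hence \<open>Y = \<sigma>\<^sup>2(x)\<close> and \<open>Z = \<sigma>(x)\<close>.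
  The homomorphisms from \<open>K\<close> to the complex numbers are permuted transitively by the cyclic group,
  so the orbit is independent of the one chosen.
\<close>

definition torus_point ::
    "(rat \<Rightarrow> 'k::comm_ring_1 \<Rightarrow> 'k) \<Rightarrow> ('k \<Rightarrow> 'k) \<Rightarrow> 'k \<Rightarrow> triple set" where
  "torus_point sc \<sigma> x =
     (let \<tau> = (SOME \<tau>. rat_alg_hom sc (\<lambda>q z. of_rat q * z) \<tau>)
      in C3_orbit (\<tau> x, \<tau> (\<sigma> (\<sigma> x)), \<tau> (\<sigma> x)))"

text \<open>
  Polynomials in \<open>U = X / \<epsilon>\<close> and \<open>V = Y / \<epsilon>\<close> are polynomials in \<open>U\<close> whose coefficients are
  polynomials in \<open>V\<close>. Here \<open>h\<close> is the map applied to the coefficients. The generator of the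
  cyclic group acts by \<open>U \<mapsto> V\<close>, \<open>V \<mapsto> Z / \<epsilon> = 1 - U - V\<close>.
\<close>

definition eval2 ::
    "('a::comm_ring_1 \<Rightarrow> 'b::comm_ring_1) \<Rightarrow> 'a poly poly \<Rightarrow> 'b \<Rightarrow> 'b \<Rightarrow> 'b" where
  "eval2 h F u v = poly (map_poly (\<lambda>p. poly (map_poly h p) v) F) u"

definition C3_invariants :: "int poly poly set" where
  "C3_invariants =
     (let U = [:0, 1:]; V = [:[:0, 1:]:]
      in {F. eval2 (\<lambda>c. [:[:c:]:]) F V (1 - U - V) = F})"

definition D0_integral :: "triple set \<Rightarrow> bool" where
  "D0_integral P \<longleftrightarrow>
     (\<forall>F \<in> C3_invariants.
        value_at P (\<lambda>(X, Y, Z). eval2 of_int F (X / aug (X, Y, Z)) (Y / aug (X, Y, Z))) \<in> \<int>)"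


section \<open>Places of the field generated by a cube root of unity\<close>

definition E_field :: "complex \<Rightarrow> complex set" where
  "E_field \<zeta> = {of_rat p + of_rat q * \<zeta> | p q. True}"

text \<open>
  The field is imaginary quadratic, so it has one infinite place, given by the absolute value of
  the ambient complex numbers. A finite place is represented by its normalised (surjective)
  discrete valuation on the nonzero elements; \<open>extensional\<close> functions are used so that each place
  is counted once.
\<close>

datatype place = Infinite | Finite "complex \<Rightarrow> int"

definition normalized_valuations :: "complex \<Rightarrow> (complex \<Rightarrow> int) set" where
  "normalized_valuations \<zeta> =
     (let U = E_field \<zeta> - {0} in
      {v \<in> extensional U.
         v ` U = UNIV \<and>
         (\<forall>x\<in>U. \<forall>y\<in>U. v (x * y) = v x + v y) \<and>
         (\<forall>x\<in>U. \<forall>y\<in>U. x + y \<noteq> 0 \<longrightarrow> min (v x) (v y) \<le> v (x + y))})"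

definition places :: "complex \<Rightarrow> place set" where
  "places \<zeta> = insert Infinite (Finite ` normalized_valuations \<zeta>)"

definition valuation_ring :: "complex \<Rightarrow> (complex \<Rightarrow> int) \<Rightarrow> complex set" where
  "valuation_ring \<zeta> v = {z \<in> E_field \<zeta>. z = 0 \<or> 0 \<le> v z}"

definition valuation_ideal :: "complex \<Rightarrow> (complex \<Rightarrow> int) \<Rightarrow> complex set" where
  "valuation_ideal \<zeta> v = {z \<in> E_field \<zeta>. z = 0 \<or> 0 < v z}"

definition residue_card :: "complex \<Rightarrow> (complex \<Rightarrow> int) \<Rightarrow> nat" where
  "residue_card \<zeta> v =
     card (valuation_ring \<zeta> v //
       {(y, z). y \<in> valuation_ring \<zeta> v \<and> z \<in> valuation_ring \<zeta> v \<and> y - z \<in> valuation_ideal \<zeta> v})"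

fun place_abs :: "complex \<Rightarrow> place \<Rightarrow> complex \<Rightarrow> real" where
  "place_abs \<zeta> Infinite z = (cmod z)\<^sup>2"
| "place_abs \<zeta> (Finite v) z = (if z = 0 then 0 else real (residue_card \<zeta> v) powi (- v z))"


section \<open>The toric height\<close>

text \<open>
  Characters are written in the basis \<open>v\<^sub>1\<^sup>\<or>, v\<^sub>2\<^sup>\<or>\<close> and (real) cocharacters in the dual basis
  \<open>v\<^sub>1, v\<^sub>2\<close>. The character lattice of the quotient torus has finite index in that of the covering
  torus, so the two have the same real cocharacter space.
\<close>

definition character :: "complex \<Rightarrow> int \<times> int \<Rightarrow> triple \<Rightarrow> complex" where
  "character \<zeta> m = (\<lambda>(X, Y, Z).
     ((X + \<zeta> * Y + \<zeta>\<^sup>2 * Z) / aug (X, Y, Z)) powi fst m *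
     ((X + \<zeta>\<^sup>2 * Y + \<zeta> * Z) / aug (X, Y, Z)) powi snd m)"

definition char_lattice :: "(int \<times> int) set" where
  "char_lattice = {(2 * r - s, 2 * s - r) | r s. True}"

definition pairing :: "int \<times> int \<Rightarrow> real \<times> real \<Rightarrow> real" where
  "pairing m n = of_int (fst m) * fst n + of_int (snd m) * snd n"

definition log_point :: "complex \<Rightarrow> place \<Rightarrow> triple set \<Rightarrow> real \<times> real" where
  "log_point \<zeta> w P =
     (THE n. \<forall>m \<in> char_lattice.
        pairing m n = - ln (place_abs \<zeta> w (value_at P (character \<zeta> m))))"

definition ray1 :: "real \<times> real" where "ray1 = (1, 0)"
definition ray2 :: "real \<times> real" where "ray2 = (0, 1)"
definition ray0 :: "real \<times> real" where "ray0 = - ray1 - ray2"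

definition cone2 :: "real \<times> real \<Rightarrow> real \<times> real \<Rightarrow> (real \<times> real) set" where
  "cone2 u v = {s *\<^sub>R u + t *\<^sub>R v | s t. 0 \<le> s \<and> 0 \<le> t}"

definition maximal_cones :: "(real \<times> real) set set" where
  "maximal_cones = {cone2 ray0 ray1, cone2 ray0 ray2, cone2 ray1 ray2}"

definition is_phi0 :: "(real \<times> real \<Rightarrow> real) \<Rightarrow> bool" where
  "is_phi0 \<phi> \<longleftrightarrow>
     continuous_on UNIV \<phi> \<and>
     (\<forall>C \<in> maximal_cones. \<exists>L. linear L \<and> (\<forall>n\<in>C. \<phi> n = L n)) \<and>
     \<phi> ray0 = -1 \<and> \<phi> ray1 = 0 \<and> \<phi> ray2 = 0"

definition phi0 :: "real \<times> real \<Rightarrow> real" where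
  "phi0 = (THE \<phi>. is_phi0 \<phi>)"

lemma phi0_eq: "phi0 n = min 0 (min (fst n) (snd n))"
proof -
  define g :: "real \<times> real \<Rightarrow> real" where "g = (\<lambda>n. min 0 (min (fst n) (snd n)))"
  have lin: "linear (\<lambda>n::real \<times> real. 0::real)" "linear (fst :: real \<times> real \<Rightarrow> real)"
    "linear (snd :: real \<times> real \<Rightarrow> real)"
    by (auto intro!: linearI)
  have "\<exists>L. linear L \<and> (\<forall>n\<in>C. g n = L n)" if "C \<in> maximal_cones" for C
  proof -
    have "(\<forall>n\<in>C. g n = snd n) \<or> (\<forall>n\<in>C. g n = fst n) \<or> (\<forall>n\<in>C. g n = 0)"
      using that unfolding maximal_cones_def cone2_def ray0_def ray1_def ray2_def g_def
      by auto
    then show ?thesis using lin by blast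
  qed
  moreover have "continuous_on UNIV g"
    unfolding g_def by (intro continuous_intros)
  ultimately have g: "is_phi0 g"
    unfolding is_phi0_def by (auto simp: g_def ray0_def ray1_def ray2_def)
  have val: "\<phi> (s *\<^sub>R u + t *\<^sub>R v) = s * \<phi> u + t * \<phi> v"
    if asm: "is_phi0 \<phi>" "cone2 u v \<in> maximal_cones" "0 \<le> s" "0 \<le> t" for \<phi> u v s t
  proof -
    obtain L where L: "linear L" "\<And>n. n \<in> cone2 u v \<Longrightarrow> \<phi> n = L n"
      using asm(1,2) unfolding is_phi0_def by blast
    have "u = 1 *\<^sub>R u + 0 *\<^sub>R v" "v = 0 *\<^sub>R u + 1 *\<^sub>R v" by simp_all
    then have "u \<in> cone2 u v" "v \<in> cone2 u v"
      unfolding cone2_def mem_Collect_eq using zero_le_one order_refl by blast+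
    moreover have "s *\<^sub>R u + t *\<^sub>R v \<in> cone2 u v"
      unfolding cone2_def using asm(3,4) by blast
    ultimately show ?thesis
      using L by (simp add: linear_add linear_scale)
  qed
  have "\<phi> = g" if p: "is_phi0 \<phi>" for \<phi>
  proof
    have rays: "\<phi> ray0 = g ray0" "\<phi> ray1 = g ray1" "\<phi> ray2 = g ray2"
      using p g unfolding is_phi0_def by simp_all
    have cones: "cone2 ray0 ray1 \<in> maximal_cones" "cone2 ray0 ray2 \<in> maximal_cones"
      "cone2 ray1 ray2 \<in> maximal_cones"
      by (simp_all add: maximal_cones_def)
    fix n :: "real \<times> real"
    obtain x y where n: "n = (x, y)" by (cases n)
    consider "0 \<le> x" "0 \<le> y" | "y \<le> x" "y \<le> 0" | "x \<le> y" "x \<le> 0" by linarith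
    then show "\<phi> n = g n"
    proof cases
      case 1
      have "n = x *\<^sub>R ray1 + y *\<^sub>R ray2" by (simp add: n ray1_def ray2_def)
      then show ?thesis using val[OF p cones(3) 1] val[OF g cones(3) 1] rays by simp
    next
      case 2
      have "n = (- y) *\<^sub>R ray0 + (x - y) *\<^sub>R ray1" by (simp add: n ray0_def ray1_def ray2_def)
      then show ?thesis using val[OF p cones(1), of "- y" "x - y"] val[OF g cones(1), of "- y" "x - y"] 2 rays by simp
    next
      case 3
      have "n = (- x) *\<^sub>R ray0 + (y - x) *\<^sub>R ray2" by (simp add: n ray0_def ray1_def ray2_def)
      then show ?thesis using val[OF p cones(2), of "- x" "y - x"] val[OF g cones(2), of "- x" "y - x"] 3 rays by simp
    qed
  qed
  with g have "phi0 = g" unfolding phi0_def by (rule the_equality)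
  show ?thesis unfolding \<open>phi0 = g\<close> by (simp only: g_def)
qed

definition local_height :: "complex \<Rightarrow> triple set \<Rightarrow> place \<Rightarrow> real" where
  "local_height \<zeta> P w = exp (- phi0 (log_point \<zeta> w P)) powr (1 / 2)"

text \<open>Almost all local factors are one, so the product over all places is the finite product over
  the places whose factor is not one.\<close>

definition D0_height :: "complex \<Rightarrow> triple set \<Rightarrow> real" where
  "D0_height \<zeta> P =
     (\<Prod>w \<in> {w \<in> places \<zeta>. local_height \<zeta> P w \<noteq> 1}. local_height \<zeta> P w)"

end

theory Submission
  imports Defs
begin

text \<open>Write \<open>x\<close>, \<open>\<sigma> x\<close>, \<open>\<sigma> (\<sigma> x)\<close> for the conjugates of the normal element. Their elementary symmetric
  functions are \<open>1\<close>, \<open>a\<close>, \<open>-b\<close>, and the point of the torus is the orbit of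
  \<open>(X, Y, Z) = (x, \<sigma> (\<sigma> x), \<sigma> x)\<close>, read in the complex numbers through a homomorphism \<open>\<tau>\<close>.

  Integrality. The invariants \<open>U V + V W + W U\<close> and \<open>U V W\<close>, where \<open>W = 1 - U - V\<close>, take the values
  \<open>a\<close> and \<open>-b\<close>, so an integral point has integral \<open>a\<close> and \<open>b\<close>. Conversely, the value of an
  invariant is fixed by \<open>\<sigma>\<close>, and a fixed element is rational, because its coordinates in the normal
  basis are all equal (\<open>fixed_rational\<close>). If \<open>a\<close> and \<open>b\<close> are integers, the value lies in the ring
  generated by \<open>x\<close> and \<open>\<sigma> (\<sigma> x)\<close>, which is a finitely generated abelian group. Hence the powers of
  this rational number have a common denominator, and it is an integer (\<open>invariant_integral\<close>).

  Height. The Lagrange resolvents \<open>y\<^sub>1 = X + \<zeta> Y + \<zeta>\<^sup>2 Z\<close> and \<open>y\<^sub>2 = X + \<zeta>\<^sup>2 Y + \<zeta> Z\<close> satisfy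
  \<open>y\<^sub>1 y\<^sub>2 = 1 - 3 a\<close>, and \<open>y\<^sub>1\<^sup>3 = A + B \<zeta> + C \<zeta>\<^sup>2\<close> with rational \<open>A\<close>, \<open>B\<close>, \<open>C\<close>. So the two cubes
  lie in the field generated by \<open>\<zeta>\<close> and are complex conjugates. The cube of the character with exponents
  \<open>(m\<^sub>1, m\<^sub>2)\<close> is a product of powers of these two cubes, which makes the local height at a place the
  number \<open>max (1, |y\<^sub>1\<^sup>3|, |y\<^sub>2\<^sup>3|)\<close> to the power \<open>1 / 6\<close>. For integral \<open>a\<close> and \<open>b\<close> both cubes are roots
  of a monic quadratic polynomial with integral coefficients, because \<open>y\<^sub>1\<^sup>3 + y\<^sub>2\<^sup>3 = 2 - 9 a - 27 b\<close> and
  \<open>y\<^sub>1\<^sup>3 y\<^sub>2\<^sup>3 = (1 - 3 a)\<^sup>3\<close>, so all finite places contribute \<open>1\<close>. At the infinite place the two absolute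
  values are equal and their product is the square of \<open>(1 - 3 a)\<^sup>3\<close>, so the contribution is the square
  root of \<open>1 - 3 a\<close> (\<open>D0_height_orbit\<close>).

  The last step needs \<open>1 - 3 a\<close> to be positive. Its cube is the norm
  \<open>A\<^sup>2 + B\<^sup>2 + C\<^sup>2 - A B - B C - C A\<close>, which is never negative. If it were zero, then \<open>A = B = C\<close>, the
  characteristic polynomial would be the cube of \<open>t - 1/3\<close>, and \<open>x = 1/3\<close> would follow since the
  algebra is reduced; but a rational element is not normal (\<open>one_minus_three_a_positive\<close>).\<close>


section \<open>Cubic algebras with a normal element of trace one\<close>

text \<open>Cubic abelian fields and the split algebra are treated alike through these common properties. That
  the algebra is reduced is what excludes \<open>1 - 3 a = 0\<close> below.\<close>

locale normal_cubic_algebra =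
  fixes sc :: "rat \<Rightarrow> 'k::comm_ring_1 \<Rightarrow> 'k" and \<sigma> :: "'k \<Rightarrow> 'k" and x :: 'k
  assumes vs: "vector_space sc"
    and sc_mult: "sc c (y * z) = sc c y * z"
    and \<sigma>_hom: "rat_alg_hom sc sc \<sigma>"
    and \<sigma>_cubed: "\<sigma> (\<sigma> (\<sigma> y)) = y"
    and indep: "sc p x + sc q (\<sigma> x) + sc r (\<sigma> (\<sigma> x)) = 0 \<Longrightarrow> p = 0 \<and> q = 0 \<and> r = 0"
    and spanning: "\<exists>p q r. y = sc p x + sc q (\<sigma> x) + sc r (\<sigma> (\<sigma> x))"
    and trace: "x + \<sigma> x + \<sigma> (\<sigma> x) = 1"
    and reduced: "y * y = 0 \<Longrightarrow> y = 0"
begin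

sublocale V: vector_space sc by (rule vs)

definition \<iota> :: "rat \<Rightarrow> 'k" where "\<iota> c = sc c 1"

lemma sc_eq: "sc c y = \<iota> c * y"
  using sc_mult[of c 1 y] by (simp add: \<iota>_def)

lemma \<iota>_add [simp]: "\<iota> (p + q) = \<iota> p + \<iota> q"
  by (simp add: \<iota>_def V.scale_left_distrib)
lemma \<iota>_mult [simp]: "\<iota> (p * q) = \<iota> p * \<iota> q"
  by (metis V.scale_scale \<iota>_def sc_eq)
lemma \<iota>_1 [simp]: "\<iota> 1 = 1"
  by (simp add: \<iota>_def)
lemma \<iota>_0 [simp]: "\<iota> 0 = 0"
  by (simp add: \<iota>_def)
lemma \<iota>_minus [simp]: "\<iota> (- p) = - \<iota> p"
  by (simp add: \<iota>_def)
lemma \<iota>_diff [simp]: "\<iota> (p - q) = \<iota> p - \<iota> q"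
  by (simp add: \<iota>_def V.scale_left_diff_distrib)
lemma \<iota>_of_nat [simp]: "\<iota> (of_nat n) = of_nat n"
  by (induction n) auto
lemma \<iota>_of_int [simp]: "\<iota> (of_int n) = of_int n"
  by (cases n) (auto simp del: of_nat_Suc)
lemma \<iota>_numeral [simp]: "\<iota> (numeral n) = numeral n"
  using \<iota>_of_int[of "numeral n"] by simp
lemma \<iota>_power [simp]: "\<iota> (p ^ n) = \<iota> p ^ n"
  by (induction n) auto

lemma one_neq_zero: "(1::'k) \<noteq> 0"
proof
  assume "(1::'k) = 0"
  then have "y = 0" for y :: 'k by (metis mult_1 mult_zero_left)
  then show False using indep[of 1 0 0] by simp
qed

lemma \<iota>_eq_0_iff [simp]: "\<iota> p = 0 \<longleftrightarrow> p = 0"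
  using one_neq_zero by (simp add: \<iota>_def)
lemma \<iota>_inj: "\<iota> p = \<iota> q \<longleftrightarrow> p = q"
  using \<iota>_eq_0_iff[of "p - q"] by (simp del: \<iota>_eq_0_iff)

declare \<sigma>_cubed [simp]

lemma \<sigma>_linear: "Vector_Spaces.linear sc sc \<sigma>"
  using \<sigma>_hom by (simp add: rat_alg_hom_def)
lemma \<sigma>_add [simp]: "\<sigma> (y + z) = \<sigma> y + \<sigma> z"
  using Vector_Spaces.linear_iff \<sigma>_linear by blast
lemma \<sigma>_1 [simp]: "\<sigma> 1 = 1" and \<sigma>_mult [simp]: "\<sigma> (y * z) = \<sigma> y * \<sigma> z"
  using \<sigma>_hom by (auto simp: rat_alg_hom_def)
lemma \<sigma>_\<iota> [simp]: "\<sigma> (\<iota> p) = \<iota> p"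
  using Vector_Spaces.linear_iff \<sigma>_linear \<sigma>_1 unfolding \<iota>_def by metis
lemma \<sigma>_0 [simp]: "\<sigma> 0 = 0" using \<sigma>_\<iota>[of 0] by simp
lemma \<sigma>_minus [simp]: "\<sigma> (- y) = - \<sigma> y"
  using \<sigma>_add[of y "-y"] by (simp add: eq_neg_iff_add_eq_0 add.commute)
lemma \<sigma>_diff [simp]: "\<sigma> (y - z) = \<sigma> y - \<sigma> z"
  using \<sigma>_add[of y "- z"] by simp
lemma \<sigma>_numeral [simp]: "\<sigma> (numeral n) = numeral n"
  using \<sigma>_\<iota>[of "numeral n"] by simp
lemma \<sigma>_power [simp]: "\<sigma> (y ^ n) = \<sigma> y ^ n"
  by (induction n) auto

lemma coordinates_unique:
  assumes "\<iota> p * x + \<iota> q * \<sigma> x + \<iota> r * \<sigma> (\<sigma> x) = \<iota> p' * x + \<iota> q' * \<sigma> x + \<iota> r' * \<sigma> (\<sigma> x)"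
  shows "p = p' \<and> q = q' \<and> r = r'"
  using indep[of "p - p'" "q - q'" "r - r'"] assms by (simp add: sc_eq algebra_simps)

text \<open>The automorphism permutes the normal basis cyclically, so the coordinates of a fixed element are all
  equal; such an element is a multiple of the trace of \<open>x\<close>, which is one.\<close>

lemma fixed_rational:
  assumes "\<sigma> y = y"
  obtains c where "y = \<iota> c"
proof -
  obtain p q r where y: "y = \<iota> p * x + \<iota> q * \<sigma> x + \<iota> r * \<sigma> (\<sigma> x)"
    using spanning[of y] by (auto simp: sc_eq)
  have "\<iota> r * x + \<iota> p * \<sigma> x + \<iota> q * \<sigma> (\<sigma> x) = \<iota> p * x + \<iota> q * \<sigma> x + \<iota> r * \<sigma> (\<sigma> x)"
    using assms unfolding y by (simp add: add_ac)
  from coordinates_unique[OF this] have "q = p" "r = p" by blast+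
  then have "y = \<iota> p * (x + \<sigma> x + \<sigma> (\<sigma> x))"
    by (simp add: y algebra_simps)
  then show thesis using that trace by simp
qed

text \<open>The coefficients of the characteristic polynomial \<open>t\<^sup>3 - t\<^sup>2 + a t + b\<close>, as the rational numbers
  that the symmetric functions of the conjugates, being fixed, are equal to.\<close>

definition coeff_a where "coeff_a = (THE c. \<iota> c = x * \<sigma> x + \<sigma> x * \<sigma> (\<sigma> x) + \<sigma> (\<sigma> x) * x)"
definition coeff_b where "coeff_b = (THE c. \<iota> c = - (x * \<sigma> x * \<sigma> (\<sigma> x)))"

lemma fixed_the:
  assumes "\<sigma> y = y" shows "\<iota> (THE c. \<iota> c = y) = y"
proof -
  obtain c where "y = \<iota> c" using fixed_rational[OF assms] .
  then show ?thesis by (simp add: \<iota>_inj)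
qed

lemma coeff_a: "\<iota> coeff_a = x * \<sigma> x + \<sigma> x * \<sigma> (\<sigma> x) + \<sigma> (\<sigma> x) * x"
  unfolding coeff_a_def by (rule fixed_the) (simp add: algebra_simps)
lemma coeff_b: "\<iota> coeff_b = - (x * \<sigma> x * \<sigma> (\<sigma> x))"
  unfolding coeff_b_def by (rule fixed_the) (simp add: algebra_simps)

lemma cubic_factors:
  "(y - x) * (y - \<sigma> x) * (y - \<sigma> (\<sigma> x)) = y ^ 3 - y ^ 2 + \<iota> coeff_a * y + \<iota> coeff_b"
proof -
  have "(y - x) * (y - \<sigma> x) * (y - \<sigma> (\<sigma> x)) =
    y ^ 3 - (x + \<sigma> x + \<sigma> (\<sigma> x)) * y ^ 2 + \<iota> coeff_a * y + \<iota> coeff_b"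
    unfolding coeff_a coeff_b by (simp add: algebra_simps power3_eq_cube power2_eq_square)
  then show ?thesis unfolding trace by simp
qed

end


section \<open>Positivity of the squared height\<close>

text \<open>The left-hand side of the first identity is the norm of \<open>A + B \<zeta> + C \<zeta>\<^sup>2\<close>, the cube of the resolvent
  \<open>X + \<zeta> Y + \<zeta>\<^sup>2 Z\<close>; on the right is the cube of the norm of that resolvent. The second identity is
  the sum of the cubes of the two resolvents, since \<open>\<zeta> + \<zeta>\<^sup>2 = -1\<close>.\<close>

lemma norm_form_cubed:
  fixes X Y Z :: "'a::comm_ring_1"
  defines "A \<equiv> X^3 + Y^3 + Z^3 + 6 * X * Y * Z"
    and "B \<equiv> 3 * (X^2 * Y + Y^2 * Z + Z^2 * X)" and "C \<equiv> 3 * (X * Y^2 + Y * Z^2 + Z * X^2)"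
  shows "A^2 + B^2 + C^2 - A * B - B * C - C * A = ((X+Y+Z)^2 - 3 * (X*Y+Y*Z+Z*X))^3"
  and "2 * A - B - C = 2 * (X+Y+Z)^3 - 9 * (X+Y+Z) * (X*Y+Y*Z+Z*X) + 27 * X * Y * Z"
  unfolding A_def B_def C_def by (simp_all add: algebra_simps power2_eq_square power3_eq_cube)

text \<open>Twice the form is the sum of the squares of the differences.\<close>

lemma norm_form_definite:
  fixes A B C :: rat
  shows "0 \<le> A^2 + B^2 + C^2 - A * B - B * C - C * A"
    and "A^2 + B^2 + C^2 - A * B - B * C - C * A = 0 \<Longrightarrow> A = B \<and> B = C"
proof -
  define N where "N = A^2 + B^2 + C^2 - A * B - B * C - C * A"
  define s t where "s = (A-B)^2" and "t = (B-C)^2 + (C-A)^2"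
  have *: "2 * N = s + t"
    unfolding N_def s_def t_def by (simp add: power2_eq_square algebra_simps)
  have nonneg: "0 \<le> s" "0 \<le> t" by (simp_all add: s_def t_def)
  with * have "0 \<le> N" by linarith
  then show "0 \<le> A^2 + B^2 + C^2 - A * B - B * C - C * A" by (simp only: N_def)
  assume "A^2 + B^2 + C^2 - A * B - B * C - C * A = 0"
  then have "N = 0" by (simp only: N_def)
  with * nonneg have "s = 0 \<and> t = 0" by linarith
  then show "A = B \<and> B = C"
    unfolding s_def t_def sum_power2_eq_zero_iff zero_eq_power2 right_minus_eq by blast
qed

context normal_cubic_algebra begin

text \<open>With \<open>(X, Y, Z) = (x, \<sigma> (\<sigma> x), \<sigma> x)\<close>, these are the coefficients \<open>A\<close>, \<open>B\<close>, \<open>C\<close> of the cube of the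
  resolvent. The automorphism \<open>\<sigma>\<close> permutes the coordinates cyclically, which leaves all three unchanged.\<close>

lemma resolvent_cube_rational:
  obtains A B C where
   "\<iota> A = x^3 + (\<sigma> (\<sigma> x))^3 + (\<sigma> x)^3 + 6 * x * \<sigma> (\<sigma> x) * \<sigma> x"
   "\<iota> B = 3 * (x^2 * \<sigma> (\<sigma> x) + (\<sigma> (\<sigma> x))^2 * \<sigma> x + (\<sigma> x)^2 * x)"
   "\<iota> C = 3 * (x * (\<sigma> (\<sigma> x))^2 + \<sigma> (\<sigma> x) * (\<sigma> x)^2 + \<sigma> x * x^2)"
proof -
  show thesis
    by (rule that; rule fixed_the; simp add: algebra_simps)
qed

text \<open>If \<open>1 - 3 a\<close> were zero, the norm form would vanish at \<open>(A, B, C)\<close>, which gives \<open>A = B = C\<close> and then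
  \<open>b = -1/27\<close>. So \<open>x - 1/3\<close> would be nilpotent.\<close>

lemma one_minus_three_a_positive: "1 - 3 * coeff_a > 0"
proof -
  obtain A B C where ABC:
   "\<iota> A = x^3 + (\<sigma> (\<sigma> x))^3 + (\<sigma> x)^3 + 6 * x * \<sigma> (\<sigma> x) * \<sigma> x"
   "\<iota> B = 3 * (x^2 * \<sigma> (\<sigma> x) + (\<sigma> (\<sigma> x))^2 * \<sigma> x + (\<sigma> x)^2 * x)"
   "\<iota> C = 3 * (x * (\<sigma> (\<sigma> x))^2 + \<sigma> (\<sigma> x) * (\<sigma> x)^2 + \<sigma> x * x^2)"
    using resolvent_cube_rational .
  have tr: "x + \<sigma> (\<sigma> x) + \<sigma> x = 1" using trace by (simp add: add_ac)
  have e2: "x * \<sigma> (\<sigma> x) + \<sigma> (\<sigma> x) * \<sigma> x + \<sigma> x * x = \<iota> coeff_a"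
    by (simp add: coeff_a algebra_simps)
  have e3: "27 * x * \<sigma> (\<sigma> x) * \<sigma> x = - (27 * \<iota> coeff_b)"
    by (simp add: coeff_b algebra_simps)
  have "\<iota> (A^2 + B^2 + C^2 - A * B - B * C - C * A) = \<iota> ((1 - 3 * coeff_a)^3)"
    using norm_form_cubed(1)[of x "\<sigma> (\<sigma> x)" "\<sigma> x"] unfolding tr e2 by (simp add: ABC)
  then have N: "A^2 + B^2 + C^2 - A * B - B * C - C * A = (1 - 3 * coeff_a)^3"
    by (simp only: \<iota>_inj)
  have "\<iota> (2 * A - B - C) = \<iota> (2 - 9 * coeff_a - 27 * coeff_b)"
    using norm_form_cubed(2)[of x "\<sigma> (\<sigma> x)" "\<sigma> x"] unfolding tr e2 e3 by (simp add: ABC)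
  then have T: "2 * A - B - C = 2 - 9 * coeff_a - 27 * coeff_b"
    by (simp only: \<iota>_inj)
  have "1 - 3 * coeff_a \<noteq> 0"
  proof
    assume 0: "1 - 3 * coeff_a = 0"
    with N norm_form_definite(2)[of A B C] have "A = B" "B = C" by simp_all
    with 0 T have ab: "coeff_a = 1/3" "coeff_b = - (1/27)"
      by linarith+
    define d where "d = x - \<iota> (1/3)"
    have "\<iota> (1/27) = \<iota> ((1/3)^3)" "\<iota> (3 * (1/3)^2) = \<iota> (1/3)" "\<iota> (3 * (1/3)) = \<iota> 1"
      by (simp_all add: \<iota>_inj power2_eq_square power3_eq_cube del: \<iota>_mult \<iota>_power)
    then have i9: "\<iota> (1/27) = \<iota> (1/3)^3" and i3: "3 * \<iota> (1/3)^2 = \<iota> (1/3)" "3 * \<iota> (1/3) = 1"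
      by (simp_all only: \<iota>_mult \<iota>_power \<iota>_numeral \<iota>_1)
    have "d ^ 3 = x ^ 3 - (3 * \<iota> (1/3)) * x ^ 2 + (3 * \<iota> (1/3)^2) * x - \<iota> (1/3)^3"
      unfolding d_def by (simp add: power2_eq_square power3_eq_cube algebra_simps)
    also have "\<dots> = 0"
      unfolding i3 using cubic_factors[of x] by (simp add: ab i9)
    finally have "(d * d) * (d * d) = 0" by (simp add: power3_eq_cube mult.assoc)
    then have "d = 0" by (auto dest!: reduced)
    then have "x = \<iota> (1/3)" by (simp add: d_def)
    then have "\<sigma> x = x" by simp
    with indep[of 1 "-1" 0] show False by (simp add: sc_eq)
  qed
  moreover have "0 \<le> (1 - 3 * coeff_a)^3" using N norm_form_definite(1)[of A B C] by simp
  ultimately show ?thesis by (simp add: zero_le_odd_power less_le)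
qed

end


section \<open>The two kinds of algebras and their complex homomorphisms\<close>

lemma independent_of_coordinates_unique:
  assumes "vector_space sc"
    and indep: "\<And>p q r. sc p u + sc q v + sc r w = 0 \<Longrightarrow> p = 0 \<and> q = 0 \<and> r = (0::'f::field)"
  shows "u \<noteq> v \<and> u \<noteq> w \<and> v \<noteq> w" and "\<not> module.dependent sc {u, v, w :: 'v::ab_group_add}"
proof -
  interpret V: vector_space sc by fact
  show ne: "u \<noteq> v \<and> u \<noteq> w \<and> v \<noteq> w"
    using indep[of 1 "-1" 0] indep[of 1 0 "-1"] indep[of 0 1 "-1"] by auto
  show "V.independent {u, v, w}"
  proof (rule V.independent_if_scalars_zero)
    fix f z assume "(\<Sum>z\<in>{u, v, w}. sc (f z) z) = 0" "z \<in> {u, v, w}"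
    then show "f z = 0" using indep[of "f u" "f v" "f w"] ne by (auto simp: add.assoc)
  qed simp
qed

lemma spanning_of_coordinates_unique:
  assumes "vector_space sc" and dim: "vector_space.dim sc UNIV = 3"
    and indep: "\<And>p q r. sc p u + sc q v + sc r w = 0 \<Longrightarrow> p = 0 \<and> q = 0 \<and> r = (0::'f::field)"
  shows "\<exists>p q r. y = sc p u + sc q v + sc r (w :: 'v::ab_group_add)"
proof -
  interpret V: vector_space sc by fact
  obtain B where B: "V.independent B" "V.span B = UNIV" "card B = 3"
    by (metis V.basis_exists dim subset_UNIV top.extremum_uniqueI)
  interpret F: finite_dimensional_vector_space sc B
    by unfold_locales (use B in \<open>auto intro: card_ge_0_finite\<close>)
  have ne: "u \<noteq> v \<and> u \<noteq> w \<and> v \<noteq> w" "V.independent {u, v, w}"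
    using independent_of_coordinates_unique[OF assms(1), of u v w] indep by blast+
  have "UNIV \<subseteq> V.span {u, v, w}"
    by (rule F.card_ge_dim_independent[OF subset_UNIV]) (use ne dim in auto)
  then have "y \<in> V.span {u, v, w}" by blast
  then obtain p q r where "y - sc p u - sc q v - sc r w = 0"
    by (auto simp: V.span_breakdown_eq)
  then have "y = sc p u + sc q v + sc r w" by (simp add: algebra_simps)
  then show ?thesis by blast
qed

lemma normal_element_coordinates:
  assumes "vector_space sc" "normal_element sc \<sigma> x"
    and "sc p x + sc q (\<sigma> x) + sc r (\<sigma> (\<sigma> x)) = 0"
  shows "p = 0 \<and> q = 0 \<and> r = 0"
proof -
  interpret V: vector_space sc by fact
  from assms(2) have d: "x \<noteq> \<sigma> x" "x \<noteq> \<sigma> (\<sigma> x)" "\<sigma> x \<noteq> \<sigma> (\<sigma> x)"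
    and i: "V.independent {x, \<sigma> x, \<sigma> (\<sigma> x)}"
    by (auto simp: normal_element_def lin_indep_list_def)
  define f where "f z = (if z = x then p else if z = \<sigma> x then q else r)" for z
  have f: "f x = p" "f (\<sigma> x) = q" "f (\<sigma> (\<sigma> x)) = r"
    using d by (auto simp: f_def)
  have "(\<Sum>z\<in>{x, \<sigma> x, \<sigma> (\<sigma> x)}. sc (f z) z) = 0"
    using d assms(3) by (simp add: f add.assoc)
  from V.independentD[OF i _ subset_refl this] show ?thesis
    by (metis f insertI1 insertI2 finite.emptyI finite_insert)
qed

lemma vector_space_complex_over_rat: "vector_space (\<lambda>q z. of_rat q * z :: complex)"
  by unfold_locales (auto simp: algebra_simps of_rat_add of_rat_mult)

lemma rat_alg_homI:
  assumes "vector_space s1" "vector_space s2" "\<And>y z. h (y + z) = h y + h z"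
    "\<And>c y. h (s1 c y) = s2 c (h y)" "h 1 = 1" "\<And>y z. h (y * z) = h y * h z"
  shows "rat_alg_hom s1 s2 h"
  using assms by (simp add: rat_alg_hom_def Vector_Spaces.linear_iff)

lemma rat_alg_homD:
  assumes "rat_alg_hom s1 s2 h"
  shows "vector_space s1" "vector_space s2" "h (y + z) = h y + h z"
    "h (s1 c y) = s2 c (h y)" "h 1 = 1" "h (y * z) = h y * h z"
  using assms by (auto simp: rat_alg_hom_def Vector_Spaces.linear_iff)

text \<open>All properties are transported from the coordinate algebra. The first coordinate is a homomorphism
  to the rational numbers and hence to the complex numbers.\<close>

lemma split_cubic_normal_cubic_algebra:
  assumes "split_cubic sc \<sigma>" "rat_algebra sc" "normal_element sc \<sigma> x" "C3_trace \<sigma> x = 1"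
  shows "normal_cubic_algebra sc \<sigma> x"
    and "\<exists>\<tau>. rat_alg_hom sc (\<lambda>q z. of_rat q * z :: complex) \<tau>"
proof -
  obtain \<phi> :: "'a \<Rightarrow> rat ^ 3" where hom: "rat_alg_hom sc (*s) \<phi>" and bij: "bij \<phi>"
    and shift: "\<And>y. \<phi> (\<sigma> y) = (\<chi> i. vec_nth (\<phi> y) (i + 1))"
    using assms(1) unfolding split_cubic_def by blast
  note \<phi> = rat_alg_homD[OF hom]
  have vs: "vector_space sc" by (rule \<phi>)
  interpret V: vector_space sc by fact
  have eqI: "y = z" if "\<phi> y = \<phi> z" for y z
    using bij that by (meson bij_is_inj injD)
  note indep = normal_element_coordinates[OF vs assms(3)]
  have \<phi>0: "\<phi> 0 = 0" using \<phi>(3)[of 0 0] by simp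
  show "normal_cubic_algebra sc \<sigma> x"
  proof
    show "sc c (y * z) = sc c y * z" for c y z
      using assms(2) by (simp add: rat_algebra_def)
    show "rat_alg_hom sc sc \<sigma>"
      by (rule rat_alg_homI; (rule eqI vs)?; simp add: \<phi> shift Finite_Cartesian_Product.vec_eq_iff)
    have "(3 :: 3) = 0" by simp
    then have three: "3 + i = i" for i :: 3 by (simp only: add_0)
    show "\<sigma> (\<sigma> (\<sigma> y)) = y" for y
      by (rule eqI) (simp add: shift three Finite_Cartesian_Product.vec_eq_iff)
    show "p = 0 \<and> q = 0 \<and> r = 0" if "sc p x + sc q (\<sigma> x) + sc r (\<sigma> (\<sigma> x)) = 0" for p q r
      using indep that .
    show "\<exists>p q r. y = sc p x + sc q (\<sigma> x) + sc r (\<sigma> (\<sigma> x))" for y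
    proof -
      have "\<exists>p q r. \<phi> y = p *s \<phi> x + q *s \<phi> (\<sigma> x) + r *s \<phi> (\<sigma> (\<sigma> x))"
      proof (rule spanning_of_coordinates_unique)
        show "vector_space ((*s) :: rat \<Rightarrow> rat ^ 3 \<Rightarrow> _)" by (rule \<phi>)
        show "vec.dim (UNIV :: (rat ^ 3) set) = 3" by (simp only: vec_dim_card) simp
        fix p q r assume "p *s \<phi> x + q *s \<phi> (\<sigma> x) + r *s \<phi> (\<sigma> (\<sigma> x)) = 0"
        then have "\<phi> (sc p x + sc q (\<sigma> x) + sc r (\<sigma> (\<sigma> x))) = \<phi> 0" by (simp add: \<phi> \<phi>0)
        from indep[OF eqI[OF this]] show "p = 0 \<and> q = 0 \<and> r = 0" .
      qed
      then obtain p q r where "\<phi> y = \<phi> (sc p x + sc q (\<sigma> x) + sc r (\<sigma> (\<sigma> x)))"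
        by (auto simp: \<phi>)
      from eqI[OF this] show ?thesis by blast
    qed
    show "x + \<sigma> x + \<sigma> (\<sigma> x) = 1"
      using assms(4) by (simp add: C3_trace_def)
    show "y = 0" if "y * y = 0" for y :: 'a
    proof (rule eqI)
      from that have "\<phi> y * \<phi> y = 0" by (metis \<phi>(6) \<phi>0)
      then show "\<phi> y = \<phi> 0" by (simp add: \<phi>0 Finite_Cartesian_Product.vec_eq_iff)
    qed
  qed
  have "rat_alg_hom sc (\<lambda>q z. of_rat q * z :: complex) (\<lambda>y. of_rat (vec_nth (\<phi> y) 0))"
    by (rule rat_alg_homI) (auto simp: vs vector_space_complex_over_rat \<phi> of_rat_add of_rat_mult)
  then show "\<exists>\<tau>. rat_alg_hom sc (\<lambda>q z. of_rat q * z :: complex) \<tau>" by blast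
qed

lemma rat_alg_Aut_comp:
  assumes "f \<in> rat_alg_Aut sc" "g \<in> rat_alg_Aut sc"
  shows "f \<circ> g \<in> rat_alg_Aut sc"
proof -
  from assms have f: "rat_alg_hom sc sc f" and g: "rat_alg_hom sc sc g" and b: "bij f" "bij g"
    by (auto simp: rat_alg_Aut_def)
  have "rat_alg_hom sc sc (f \<circ> g)"
    by (rule rat_alg_homI) (simp_all add: rat_alg_homD[OF f] rat_alg_homD[OF g])
  with b show ?thesis by (simp add: rat_alg_Aut_def bij_comp)
qed

text \<open>The relation \<open>\<sigma> (\<sigma> (\<sigma> y)) = y\<close> comes from counting automorphisms: the cube of \<open>\<sigma>\<close> is one of the
  three, and cancelling shows that it can only be the identity.\<close>

lemma cubic_abelian_field_normal_cubic_algebra: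
  assumes "cubic_abelian_field sc \<sigma>" "rat_algebra sc" "normal_element sc \<sigma> x" "C3_trace \<sigma> x = 1"
  shows "normal_cubic_algebra sc \<sigma> x"
proof (rule normal_cubic_algebra.intro)
  show vs: "vector_space sc"
    using assms(2) by (simp add: rat_algebra_def)
  show "sc c (y * z) = sc c y * z" for c y z
    using assms(2) by (simp add: rat_algebra_def)
  have inv: "\<exists>z. y * z = 1" if "y \<noteq> 0" for y :: 'a
    using assms(1) that by (auto simp: cubic_abelian_field_def)
  have dim: "vector_space.dim sc (UNIV :: 'a set) = 3"
    and card: "card {id, \<sigma>, \<sigma> \<circ> \<sigma>} = 3" and Aut: "rat_alg_Aut sc = {id, \<sigma>, \<sigma> \<circ> \<sigma>}"
    using assms(1) by (auto simp: cubic_abelian_field_def)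
  have \<sigma>: "\<sigma> \<in> rat_alg_Aut sc" by (simp add: Aut)
  then show "rat_alg_hom sc sc \<sigma>" by (simp add: rat_alg_Aut_def)
  have inj: "inj \<sigma>" using \<sigma> by (simp add: rat_alg_Aut_def bij_is_inj)
  have ne: "\<sigma> \<noteq> id" "\<sigma> \<circ> \<sigma> \<noteq> id"
    using card by (auto simp: card_insert_if split: if_splits)
  have "\<sigma> \<circ> (\<sigma> \<circ> \<sigma>) \<in> {id, \<sigma>, \<sigma> \<circ> \<sigma>}"
    using rat_alg_Aut_comp[OF \<sigma> rat_alg_Aut_comp[OF \<sigma> \<sigma>]] Aut by simp
  moreover have "\<sigma> \<circ> (\<sigma> \<circ> \<sigma>) \<noteq> \<sigma>" "\<sigma> \<circ> (\<sigma> \<circ> \<sigma>) \<noteq> \<sigma> \<circ> \<sigma>"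
    using ne inj by (auto simp: fun_eq_iff inj_eq)
  ultimately have "\<sigma> \<circ> (\<sigma> \<circ> \<sigma>) = id" by blast
  then show "\<sigma> (\<sigma> (\<sigma> y)) = y" for y by (metis comp_apply id_apply)
  show "p = 0 \<and> q = 0 \<and> r = 0" if "sc p x + sc q (\<sigma> x) + sc r (\<sigma> (\<sigma> x)) = 0" for p q r
    using normal_element_coordinates[OF vs assms(3) that] .
  then show "\<exists>p q r. y = sc p x + sc q (\<sigma> x) + sc r (\<sigma> (\<sigma> x))" for y
    by (rule spanning_of_coordinates_unique[OF vs dim])
  show "x + \<sigma> x + \<sigma> (\<sigma> x) = 1"
    using assms(4) by (simp add: C3_trace_def)
  show "y = 0" if "y * y = 0" for y :: 'a
  proof (rule ccontr)
    assume "y \<noteq> 0"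
    then obtain z where "y * z = 1" using inv by blast
    then have "y = y * y * z" by (simp add: mult.assoc)
    with that \<open>y \<noteq> 0\<close> show False by simp
  qed
qed

context normal_cubic_algebra begin

interpretation \<iota>: comm_ring_hom \<iota>
  by unfold_locales simp_all

text \<open>In a field, \<open>1\<close>, \<open>x\<close>, \<open>x\<^sup>2\<close> are linearly independent: \<open>\<sigma>\<close> maps a quadratic relation for \<open>x\<close> to
  one for \<open>\<sigma> x\<close>, and dividing the difference by \<open>x - \<sigma> x\<close> leaves a linear relation between the conjugates.
  So the field is the quotient of the polynomial ring by the cubic \<open>f\<close>, and a complex root of \<open>f\<close>
  defines the embedding.\<close>

lemma complex_embedding_of_field:
  assumes inv: "\<And>y::'k. y \<noteq> 0 \<Longrightarrow> \<exists>z. y * z = 1"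
    and dim: "vector_space.dim sc (UNIV :: 'k set) = 3"
  shows "\<exists>\<tau>. rat_alg_hom sc (\<lambda>q z. of_rat q * z :: complex) \<tau>"
proof -
  have cancel: "z = 0" if "y \<noteq> 0" "y * z = 0" for y z :: 'k
  proof -
    obtain y' where "y * y' = 1" using inv[OF \<open>y \<noteq> 0\<close>] by blast
    then have "z = y' * (y * z)" by (metis mult.assoc mult.commute mult_1)
    with that show ?thesis by simp
  qed
  have powers_indep: "p = 0 \<and> q = 0 \<and> r = 0" if "sc p 1 + sc q x + sc r (x * x) = 0" for p q r
  proof -
    have "x - \<sigma> x \<noteq> 0" using indep[of 1 "-1" 0] by (auto simp: sc_eq)
    have 0: "\<iota> p + \<iota> q * x + \<iota> r * (x * x) = 0" using that by (simp add: sc_eq)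
    then have "\<sigma> (\<iota> p + \<iota> q * x + \<iota> r * (x * x)) = 0" by (simp del: \<sigma>_add)
    then have 1: "\<iota> p + \<iota> q * \<sigma> x + \<iota> r * (\<sigma> x * \<sigma> x) = 0" by simp
    have "(x - \<sigma> x) * (\<iota> q + \<iota> r * (x + \<sigma> x)) =
      (\<iota> p + \<iota> q * x + \<iota> r * (x * x)) - (\<iota> p + \<iota> q * \<sigma> x + \<iota> r * (\<sigma> x * \<sigma> x))"
      by (simp add: algebra_simps)
    with 0 1 have "(x - \<sigma> x) * (\<iota> q + \<iota> r * (x + \<sigma> x)) = 0" by simp
    then have "\<iota> q + \<iota> r * (x + \<sigma> x) = 0" using cancel \<open>x - \<sigma> x \<noteq> 0\<close> by blast
    moreover have "\<iota> q = \<iota> q * (x + \<sigma> x + \<sigma> (\<sigma> x))" by (simp add: trace)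
    ultimately have "\<iota> q * (x + \<sigma> x + \<sigma> (\<sigma> x)) + \<iota> r * (x + \<sigma> x) = 0" by simp
    then have "sc (q + r) x + sc (q + r) (\<sigma> x) + sc q (\<sigma> (\<sigma> x)) = 0"
      by (simp add: sc_eq algebra_simps)
    from indep[OF this] have "q = 0" "r = 0" by auto
    with 0 show ?thesis by simp
  qed
  interpret Pk: map_poly_comm_ring_hom \<iota> ..
  interpret Pc: map_poly_comm_ring_hom "of_rat :: rat \<Rightarrow> complex" ..
  define f where "f = [:coeff_b, coeff_a, -1, 1:]"
  define ev where "ev g = poly (map_poly \<iota> g) x" for g
  have ev_hom: "ev (g + h) = ev g + ev h" "ev (g * h) = ev g * ev h" "ev [:c:] = \<iota> c" "ev 1 = 1" for g h c
    by (simp_all add: ev_def hom_distribs)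
  have ev_surj: "\<exists>g. ev g = y" for y
  proof -
    obtain p q r where "y = sc p 1 + sc q x + sc r (x * x)"
      using spanning_of_coordinates_unique[OF vs dim powers_indep] by blast
    then have "ev [:p, q, r:] = y"
      by (simp add: ev_def sc_eq algebra_simps hom_distribs)
    then show ?thesis by blast
  qed
  have "ev f = 0"
    using cubic_factors[of x] by (simp add: ev_def f_def algebra_simps power2_eq_square power3_eq_cube)
  have "\<not> constant (poly (map_poly of_rat f :: complex poly))"
    by (simp add: constant_degree f_def)
  then obtain t :: complex where t: "poly (map_poly of_rat f) t = 0"
    using fundamental_theorem_of_algebra by blast
  define ev' where "ev' g = poly (map_poly of_rat g) t" for g
  have ev'_hom: "ev' (g + h) = ev' g + ev' h" "ev' (g * h) = ev' g * ev' h"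
    "ev' [:c:] = of_rat c" "ev' 1 = 1" for g h c
    by (simp_all add: ev'_def hom_distribs)
  have kernel: "ev' g = 0" if "ev g = 0" for g
  proof -
    let ?m = "g mod f"
    have g: "g = f * (g div f) + ?m" by simp
    have "ev ?m = 0"
      using that \<open>ev f = 0\<close> arg_cong[OF g, of ev] unfolding ev_hom by simp
    have "degree ?m < 3"
      using degree_mod_less[of f g] by (auto simp: f_def)
    then have "?m = [:coeff ?m 0, coeff ?m 1, coeff ?m 2:]"
      by (intro poly_eqI) (auto simp: coeff_pCons coeff_eq_0 split: nat.split simp: numeral_2_eq_2)
    then obtain p q r where m: "?m = [:p, q, r:]" by blast
    have "sc p 1 + sc q x + sc r (x * x) = 0"
      using \<open>ev ?m = 0\<close> unfolding m by (simp add: ev_def sc_eq algebra_simps hom_distribs)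
    from powers_indep[OF this] have "?m = 0" by (simp add: m)
    then show ?thesis by (subst g) (simp add: ev'_hom t[folded ev'_def] del: mod_mult_self1)
  qed
  \<comment> \<open>The kernel condition makes the value independent of the polynomial chosen.\<close>
  define \<tau> where "\<tau> y = ev' (SOME g. ev g = y)" for y
  have \<tau>: "\<tau> (ev g) = ev' g" for g
  proof -
    let ?h = "SOME h. ev h = ev g"
    have "ev ?h = ev g" by (rule someI) simp
    then have "ev (?h + [:-1:] * g) = 0" unfolding ev_hom by simp
    from kernel[OF this] have "ev' ?h = ev' g" unfolding ev'_hom by simp
    then show ?thesis by (simp add: \<tau>_def)
  qed
  have "rat_alg_hom sc (\<lambda>q z. of_rat q * z) \<tau>"
  proof (rule rat_alg_homI)
    fix y z :: 'k and c
    obtain g h where y: "y = ev g" and z: "z = ev h" using ev_surj by metis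
    show "\<tau> (y + z) = \<tau> y + \<tau> z" "\<tau> (y * z) = \<tau> y * \<tau> z"
      unfolding y z \<tau> ev_hom[symmetric] by (rule ev'_hom)+
    have "sc c y = ev ([:c:] * g)" by (simp only: ev_hom sc_eq y)
    then show "\<tau> (sc c y) = of_rat c * \<tau> y" by (simp only: \<tau> ev'_hom y)
    show "\<tau> 1 = 1" using \<tau>[of 1] by (simp only: ev_hom ev'_hom)
  qed (rule vs vector_space_complex_over_rat)+
  then show ?thesis by blast
qed

end


section \<open>The characteristic polynomial\<close>

locale embedded_normal_cubic_algebra = normal_cubic_algebra +
  fixes \<tau> :: "'a \<Rightarrow> complex"
  assumes \<tau>_hom: "rat_alg_hom sc (\<lambda>q z. of_rat q * z) \<tau>"
begin

lemma \<tau>_add [simp]: "\<tau> (y + z) = \<tau> y + \<tau> z"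
  and \<tau>_1 [simp]: "\<tau> 1 = 1"
  and \<tau>_mult [simp]: "\<tau> (y * z) = \<tau> y * \<tau> z"
  using rat_alg_homD[OF \<tau>_hom] by blast+

lemma \<tau>_\<iota> [simp]: "\<tau> (\<iota> p) = of_rat p"
  using rat_alg_homD(4)[OF \<tau>_hom, of p 1] by (simp add: \<iota>_def)

lemma \<tau>_0 [simp]: "\<tau> 0 = 0" using \<tau>_\<iota>[of 0] by simp
lemma \<tau>_minus [simp]: "\<tau> (- y) = - \<tau> y"
  using \<tau>_add[of y "-y"] by (simp add: eq_neg_iff_add_eq_0 add.commute)
lemma \<tau>_numeral [simp]: "\<tau> (numeral n) = numeral n"
  using \<tau>_\<iota>[of "numeral n"] by simp
lemma \<tau>_power [simp]: "\<tau> (y ^ n) = \<tau> y ^ n"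
  by (induction n) auto
lemma conjugates_sum: "\<tau> x + \<tau> (\<sigma> x) + \<tau> (\<sigma> (\<sigma> x)) = 1"
  using arg_cong[OF trace, of \<tau>] by simp
lemma conjugates_sum2: "\<tau> x * \<tau> (\<sigma> x) + \<tau> (\<sigma> x) * \<tau> (\<sigma> (\<sigma> x)) + \<tau> (\<sigma> (\<sigma> x)) * \<tau> x = of_rat coeff_a"
  by (rule arg_cong[OF coeff_a, of \<tau>, unfolded \<tau>_\<iota> \<tau>_add \<tau>_mult, symmetric])
lemma conjugates_prod: "\<tau> x * \<tau> (\<sigma> x) * \<tau> (\<sigma> (\<sigma> x)) = - of_rat coeff_b"
  unfolding arg_cong[OF coeff_b, of \<tau>, unfolded \<tau>_\<iota> \<tau>_minus \<tau>_mult] by simp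

lemma conjugates_independent:
  "x \<noteq> \<sigma> x \<and> x \<noteq> \<sigma> (\<sigma> x) \<and> \<sigma> x \<noteq> \<sigma> (\<sigma> x)" "V.independent {x, \<sigma> x, \<sigma> (\<sigma> x)}"
  using independent_of_coordinates_unique[OF vs, of x "\<sigma> x" "\<sigma> (\<sigma> x)"] indep by blast+

lemma conjugates_span: "V.span {x, \<sigma> x, \<sigma> (\<sigma> x)} = UNIV"
proof -
  have "y \<in> V.span {x, \<sigma> x, \<sigma> (\<sigma> x)}" for y
  proof -
    obtain p q r where "y = sc p x + sc q (\<sigma> x) + sc r (\<sigma> (\<sigma> x))"
      using spanning by blast
    then show ?thesis by (auto intro!: V.span_add V.span_scale intro: V.span_base)
  qed
  then show ?thesis by blast
qed

lemma is_mult_matrix_length: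
  assumes "is_mult_matrix sc x bs A" shows "length bs = 3"
proof -
  have bs: "distinct bs" "V.independent (set bs)" "V.span (set bs) = UNIV"
    using assms by (auto simp: is_mult_matrix_def lin_indep_list_def)
  have "card (set bs) = card {x, \<sigma> x, \<sigma> (\<sigma> x)}"
    using bs conjugates_independent(2) conjugates_span by (metis V.dim_eq_card)
  also have "\<dots> = 3" using conjugates_independent(1) by auto
  finally show ?thesis using bs(1) by (simp add: distinct_card)
qed

text \<open>Let \<open>W\<close> be the matrix of the values of the three homomorphisms \<open>\<tau>\<close>, \<open>\<tau> \<sigma>\<close>, \<open>\<tau> \<sigma>\<^sup>2\<close> at the given
  basis. The homomorphisms are eigenvectors for multiplication by \<open>x\<close>, that is \<open>W A = D W\<close> with \<open>D\<close> the diagonal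
  matrix of the conjugates of \<open>x\<close>. So the characteristic polynomial of \<open>A\<close> is that of \<open>D\<close>, once \<open>W\<close> is known
  to be invertible. A base change turns \<open>W\<close> into the matrix \<open>N\<close> of its values at the normal basis, whose
  inverse is explicit: with \<open>J\<close> the matrix of ones, \<open>N\<^sup>2 = (1 - 3 a) I + a J\<close> and \<open>N J = J\<close> give
  \<open>N (N - a J) = (1 - 3 a) I\<close>.\<close>

lemma char_poly_is_mult_matrix:
  assumes "is_mult_matrix sc x bs A"
  shows "char_poly A = [:coeff_b, coeff_a, -1, 1:]"
proof -
  have len: "length bs = 3" by (rule is_mult_matrix_length) fact
  have bs: "distinct bs" "V.span (set bs) = UNIV" and A: "A \<in> carrier_mat 3 3"
    and mult: "\<And>j. j < 3 \<Longrightarrow> x * bs ! j = (\<Sum>i<3. sc (A $$ (i, j)) (bs ! i))"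
    using assms len by (auto simp: is_mult_matrix_def lin_indep_list_def)
  define h where "h k y = \<tau> ((\<sigma> ^^ k) y)" for k y
  have h_mult: "h k (y * z) = h k y * h k z" and h_add: "h k (y + z) = h k y + h k z"
    and h_sc: "h k (sc c y) = of_rat c * h k y" and h_0: "h k 0 = 0" for k y z c
  proof -
    have "(\<sigma> ^^ k) (y * z) = (\<sigma> ^^ k) y * (\<sigma> ^^ k) z" "(\<sigma> ^^ k) (y + z) = (\<sigma> ^^ k) y + (\<sigma> ^^ k) z"
      "(\<sigma> ^^ k) (\<iota> c * y) = \<iota> c * (\<sigma> ^^ k) y" "(\<sigma> ^^ k) 0 = 0"
      by (induction k) simp_all
    then show "h k (y * z) = h k y * h k z" "h k (y + z) = h k y + h k z"
      "h k (sc c y) = of_rat c * h k y" "h k 0 = 0"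
      by (simp_all add: h_def sc_eq)
  qed
  have h_sum: "h k (\<Sum>i\<in>I. sc (c i) (y i)) = (\<Sum>i\<in>I. of_rat (c i) * h k (y i))"
    for k I and c :: "nat \<Rightarrow> rat" and y
    by (induction I rule: infinite_finite_induct) (simp_all add: h_add h_sc h_0)
  have in_bs: "\<exists>c. y = (\<Sum>i<3. sc (c i) (bs ! i))" for y
  proof -
    have "y \<in> V.span (set bs)" using bs by simp
    then obtain u where "y = (\<Sum>v\<in>set bs. sc (u v) v)"
      by (auto simp: V.span_finite)
    also have "\<dots> = (\<Sum>i<3. sc (u (bs ! i)) (bs ! i))"
      by (rule sum.reindex_bij_betw[symmetric], rule bij_betw_nth) (use bs len in auto)
    finally show ?thesis by (rule exI[of _ "\<lambda>i. u (bs ! i)"])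
  qed
  have "\<forall>j. \<exists>c. (\<sigma> ^^ j) x = (\<Sum>i<3. sc (c i) (bs ! i))"
    by (intro allI in_bs)
  from choice[OF this] obtain c where c: "\<And>j. (\<sigma> ^^ j) x = (\<Sum>i<3. sc (c j i) (bs ! i))"
    by blast
  define t where "t k = h k x" for k
  define N where "N = mat 3 3 (\<lambda>(k, j). h k ((\<sigma> ^^ j) x))"
  define N' where "N' = mat 3 3 (\<lambda>(k, j). (h k ((\<sigma> ^^ j) x) - of_rat coeff_a) / (1 - 3 * of_rat coeff_a))"
  define W where "W = mat 3 3 (\<lambda>(k, i). h k (bs ! i))"
  define B where "B = mat 3 3 (\<lambda>(i, j). complex_of_rat (c j i))"
  define D where "D = mat 3 3 (\<lambda>(i, j). if i = j then t i else 0)"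
  have carrier: "N \<in> carrier_mat 3 3" "N' \<in> carrier_mat 3 3" "W \<in> carrier_mat 3 3"
    "B \<in> carrier_mat 3 3" "D \<in> carrier_mat 3 3"
    by (simp_all add: N_def N'_def W_def B_def D_def)
  have less3: "k = 0 \<or> k = 1 \<or> k = 2" if "k < 3" for k :: nat using that by auto
  have sum3: "(\<Sum>i<3. f i) = f 0 + f 1 + f 2" for f :: "nat \<Rightarrow> complex"
    by (simp add: numeral_3_eq_3 numeral_2_eq_2)
  have h_x: "h 0 y = \<tau> y" "h 1 y = \<tau> (\<sigma> y)" "h 2 y = \<tau> (\<sigma> (\<sigma> y))"
    and pow_x: "(\<sigma> ^^ 0) y = y" "(\<sigma> ^^ 1) y = \<sigma> y" "(\<sigma> ^^ 2) y = \<sigma> (\<sigma> y)" for y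
    by (simp_all add: h_def numeral_2_eq_2)
  have "complex_of_rat (1 - 3 * coeff_a) \<noteq> 0" using one_minus_three_a_positive by simp
  then have nz: "1 - 3 * complex_of_rat coeff_a \<noteq> 0" by (simp add: of_rat_diff of_rat_mult)
  have WB: "W * B = N"
  proof (rule eq_matI)
    fix k j assume kj: "k < dim_row N" "j < dim_col N"
    then have "(W * B) $$ (k, j) = (\<Sum>i<3. h k (bs ! i) * of_rat (c j i))"
      by (simp add: W_def B_def N_def scalar_prod_def lessThan_atLeast0)
    also have "\<dots> = h k (\<Sum>i<3. sc (c j i) (bs ! i))"
      by (simp add: h_sum mult.commute)
    finally show "(W * B) $$ (k, j) = N $$ (k, j)"
      using kj by (simp add: N_def c[symmetric])
  qed (simp_all add: W_def B_def N_def)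
  \<comment> \<open>\<open>rows\<close> and \<open>products\<close> are the entries of \<open>N J\<close> and \<open>N\<^sup>2\<close>.\<close>
  note sum1 = conjugates_sum and sum2 = conjugates_sum2
  have "\<tau> x * \<tau> x + \<tau> (\<sigma> x) * \<tau> (\<sigma> x) + \<tau> (\<sigma> (\<sigma> x)) * \<tau> (\<sigma> (\<sigma> x)) =
    (\<tau> x + \<tau> (\<sigma> x) + \<tau> (\<sigma> (\<sigma> x))) * (\<tau> x + \<tau> (\<sigma> x) + \<tau> (\<sigma> (\<sigma> x))) - 2 *
    (\<tau> x * \<tau> (\<sigma> x) + \<tau> (\<sigma> x) * \<tau> (\<sigma> (\<sigma> x)) + \<tau> (\<sigma> (\<sigma> x)) * \<tau> x)"
    by (simp add: algebra_simps)
  then have squares: "\<tau> x * \<tau> x + \<tau> (\<sigma> x) * \<tau> (\<sigma> x) + \<tau> (\<sigma> (\<sigma> x)) * \<tau> (\<sigma> (\<sigma> x)) =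
    1 - 2 * of_rat coeff_a"
    unfolding sum1 sum2 by simp
  have rows: "(\<Sum>i<3. h k ((\<sigma> ^^ i) x)) = 1" if "k < 3" for k
    using less3[OF that] sum1 by (elim disjE) (simp_all only: sum3 h_x pow_x \<sigma>_cubed add_ac)
  have products: "(\<Sum>i<3. h k ((\<sigma> ^^ i) x) * h i ((\<sigma> ^^ j) x)) =
    (if k = j then 1 - 2 * of_rat coeff_a else of_rat coeff_a)" if "k < 3" "j < 3" for k j
    using less3[OF that(1)] less3[OF that(2)] squares sum2
    by (elim disjE) (simp_all add: sum3 h_x pow_x ac_simps del: One_nat_def)
  have NN: "N * N' = 1\<^sub>m 3"
  proof (rule eq_matI)
    fix k j assume "k < dim_row (1\<^sub>m 3 :: complex mat)" "j < dim_col (1\<^sub>m 3 :: complex mat)"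
    then have kj: "k < 3" "j < 3" by simp_all
    let ?a = "complex_of_rat coeff_a"
    have "(N * N') $$ (k, j) =
      (\<Sum>i<3. h k ((\<sigma> ^^ i) x) * ((h i ((\<sigma> ^^ j) x) - ?a) / (1 - 3 * ?a)))"
      using kj by (simp add: N_def N'_def scalar_prod_def lessThan_atLeast0)
    also have "\<dots> = ((\<Sum>i<3. h k ((\<sigma> ^^ i) x) * h i ((\<sigma> ^^ j) x)) - ?a * (\<Sum>i<3. h k ((\<sigma> ^^ i) x))) / (1 - 3 * ?a)"
      by (simp add: sum_divide_distrib sum_subtractf sum_distrib_left right_diff_distrib diff_divide_distrib mult.commute)
    also have "\<dots> = 1\<^sub>m 3 $$ (k, j)"
      using kj nz by (simp add: rows products)
    finally show "(N * N') $$ (k, j) = 1\<^sub>m 3 $$ (k, j)" .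
  qed (simp_all add: N_def N'_def)
  have WA: "W * map_mat of_rat A = D * W"
  proof (rule eq_matI)
    fix k j assume "k < dim_row (D * W)" "j < dim_col (D * W)"
    then have kj: "k < 3" "j < 3" by (simp_all add: D_def W_def)
    have "(W * map_mat of_rat A) $$ (k, j) = (\<Sum>i<3. h k (bs ! i) * of_rat (A $$ (i, j)))"
      using kj A by (simp add: W_def scalar_prod_def lessThan_atLeast0)
    also have "\<dots> = h k (x * bs ! j)"
      unfolding mult[OF kj(2)] by (simp add: h_sum mult.commute)
    also have "\<dots> = (\<Sum>i<3. (if k = i then t k else 0) * h i (bs ! j))"
      using kj by (simp add: h_mult t_def if_distrib[of "\<lambda>z. z * _"] cong: if_cong)
    also have "\<dots> = (D * W) $$ (k, j)"
      using kj by (simp add: D_def W_def scalar_prod_def lessThan_atLeast0)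
    finally show "(W * map_mat of_rat A) $$ (k, j) = (D * W) $$ (k, j)" .
  qed (use A in \<open>simp_all add: W_def D_def\<close>)
  have S: "B * N' \<in> carrier_mat 3 3" and AC: "map_mat complex_of_rat A \<in> carrier_mat 3 3"
    using carrier A by auto
  have WS: "W * (B * N') = 1\<^sub>m 3"
    unfolding assoc_mult_mat[OF carrier(3,4,2), symmetric] WB by (rule NN)
  have SW: "(B * N') * W = 1\<^sub>m 3"
    by (rule mat_mult_left_right_inverse[OF carrier(3) S WS])
  have "(B * N') * D * W = (B * N') * (W * map_mat of_rat A)"
    unfolding WA by (rule assoc_mult_mat[OF S carrier(5,3)])
  also have "\<dots> = map_mat of_rat A"
    unfolding assoc_mult_mat[OF S carrier(3) AC, symmetric] SW by (rule left_mult_one_mat[OF AC])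
  finally have "map_mat of_rat A = (B * N') * D * W" by (rule sym)
  then have "similar_mat_wit (map_mat of_rat A) D (B * N') W"
    by (rule similar_mat_witI[OF SW WS _ AC carrier(5) S carrier(3)])
  then have "char_poly (map_mat of_rat A) = char_poly D"
    by (intro char_poly_similar) (auto simp: similar_mat_def)
  also have "\<dots> = (\<Prod>a\<leftarrow>diag_mat D. [:- a, 1:])"
    by (rule char_poly_upper_triangular) (use carrier in \<open>auto simp: D_def\<close>)
  also have "diag_mat D = [t 0, t 1, t 2]"
    by (simp add: diag_mat_def D_def upt_conv_Cons numeral_3_eq_3 numeral_2_eq_2)
  also have "(\<Prod>a\<leftarrow>[t 0, t 1, t 2]. [:- a, 1:]) = map_poly of_rat [:coeff_b, coeff_a, -1, 1:]"
  proof -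
    have "(\<Prod>a\<leftarrow>[t 0, t 1, t 2]. [:- a, 1:]) =
      [:- (t 0 * t 1 * t 2), t 0 * t 1 + t 1 * t 2 + t 2 * t 0, - (t 0 + t 1 + t 2), 1:]"
      by (simp add: algebra_simps)
    also have "t 0 + t 1 + t 2 = 1"
      using conjugates_sum by (simp add: t_def h_def numeral_2_eq_2)
    also have "t 0 * t 1 + t 1 * t 2 + t 2 * t 0 = of_rat coeff_a"
      using conjugates_sum2 by (simp add: t_def h_def numeral_2_eq_2)
    also have "t 0 * t 1 * t 2 = - of_rat coeff_b"
      using conjugates_prod by (simp add: t_def h_def numeral_2_eq_2)
    finally show ?thesis by (simp add: map_poly_pCons)
  qed
  finally have eq: "map_poly complex_of_rat (char_poly A) = map_poly of_rat [:coeff_b, coeff_a, -1, 1:]"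
    by (simp only: of_rat_hom.char_poly_hom[OF A])
  interpret P: map_poly_inj_idom_hom "of_rat :: rat \<Rightarrow> complex" ..
  show ?thesis using eq by (simp only: P.eq_iff)
qed

lemma alg_char_poly_eq: "alg_char_poly sc x = [:coeff_b, coeff_a, -1, 1:]"
proof -
  let ?bs = "[x, \<sigma> x, \<sigma> (\<sigma> x)]"
  have "\<forall>y. \<exists>c. y = (\<Sum>i<3. sc (c i) (?bs ! i))"
  proof
    fix y
    obtain p q r where "y = sc p x + sc q (\<sigma> x) + sc r (\<sigma> (\<sigma> x))"
      using spanning by blast
    then have "y = (\<Sum>i<3. sc ([p, q, r] ! i) (?bs ! i))"
      by (simp add: numeral_3_eq_3 add.assoc)
    then show "\<exists>c. y = (\<Sum>i<3. sc (c i) (?bs ! i))" by (rule exI[of _ "(!) [p, q, r]"])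
  qed
  from choice[OF this] obtain c where c: "\<And>y. y = (\<Sum>i<3. sc (c y i) (?bs ! i))" by blast
  have "is_mult_matrix sc x ?bs (mat 3 3 (\<lambda>(i, j). c (x * ?bs ! j) i))"
    unfolding is_mult_matrix_def lin_indep_list_def
  proof (intro conjI allI impI)
    fix j assume "j < length ?bs"
    then have "(\<Sum>i<3. sc (c (x * ?bs ! j) i) (?bs ! i)) =
      (\<Sum>i<3. sc (mat 3 3 (\<lambda>(i, j). c (x * ?bs ! j) i) $$ (i, j)) (?bs ! i))"
      by (intro sum.cong) auto
    with c[of "x * ?bs ! j"] show "x * ?bs ! j =
      (\<Sum>i<length ?bs. sc (mat 3 3 (\<lambda>(i, j). c (x * ?bs ! j) i) $$ (i, j)) (?bs ! i))"
      by (simp only: list.size) (simp only: numeral_3_eq_3 add_0 add_Suc_right add_0_right One_nat_def)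
  qed (use conjugates_independent conjugates_span in auto)
  then show ?thesis
    unfolding alg_char_poly_def
    by (intro the_equality) (use char_poly_is_mult_matrix in \<open>metis+\<close>)
qed

end


section \<open>Invariant polynomials and integral points\<close>

lemma eval_hom:
  fixes h :: "'a::comm_ring_1 \<Rightarrow> 'b::comm_ring_1"
  assumes "comm_ring_hom h"
  shows "comm_ring_hom (\<lambda>p. poly (map_poly h p) v)"
proof -
  interpret comm_ring_hom h by fact
  interpret P: map_poly_comm_ring_hom h ..
  show ?thesis by unfold_locales (simp_all add: hom_distribs)
qed

lemma eval2_hom: "comm_ring_hom h \<Longrightarrow> comm_ring_hom (\<lambda>F. eval2 h F u v)"
  unfolding eval2_def by (intro eval_hom)

lemma hom_eval:
  assumes "comm_ring_hom h" "comm_ring_hom g"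
  shows "g (poly (map_poly h p) v) = poly (map_poly (\<lambda>c. g (h c)) p) (g v)"
proof -
  interpret h: comm_ring_hom h by fact
  interpret g: comm_ring_hom g by fact
  show ?thesis
    by (induction p) (simp_all add: map_poly_pCons hom_distribs)
qed

lemma hom_eval2:
  assumes "comm_ring_hom h" "comm_ring_hom g"
  shows "g (eval2 h F u v) = eval2 (\<lambda>c. g (h c)) F (g u) (g v)"
  unfolding eval2_def
  by (simp only: hom_eval[OF eval_hom[OF assms(1)] assms(2)] hom_eval[OF assms])

lemma eval2_generators:
  assumes "comm_ring_hom h"
  shows "eval2 h [:0, 1:] u v = u" "eval2 h [:[:0, 1:]:] u v = v" "eval2 h [:[:c:]:] u v = h c"
proof -
  interpret comm_ring_hom h by fact
  show "eval2 h [:0, 1:] u v = u" "eval2 h [:[:0, 1:]:] u v = v" "eval2 h [:[:c:]:] u v = h c"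
    by (simp_all add: eval2_def map_poly_pCons) (cases "c = 0", simp_all)?
qed

lemma const_const_hom: "comm_ring_hom (\<lambda>c::int. [:[:c:]:])"
  by unfold_locales (simp_all add: one_pCons)

lemma of_int_ring_hom: "comm_ring_hom (of_int :: int \<Rightarrow> 'a::comm_ring_1)"
  by unfold_locales simp_all

text \<open>An identity between polynomials in \<open>U\<close> and \<open>V\<close> with integral coefficients may be evaluated at any two
  elements of any commutative ring. This is used both in the complex numbers and in the cubic algebra.\<close>

lemma eval2_invariant:
  fixes u v :: "'a::comm_ring_1"
  assumes "F \<in> C3_invariants"
  shows "eval2 of_int F v (1 - u - v) = eval2 of_int F u v"
proof -
  let ?ev = "\<lambda>G. eval2 of_int G u v"
  interpret ev: comm_ring_hom ?ev
    by (rule eval2_hom[OF of_int_ring_hom])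
  have "F = eval2 (\<lambda>c. [:[:c:]:]) F [:[:0, 1:]:] (1 - [:0, 1:] - [:[:0, 1:]:])"
    using assms by (simp add: C3_invariants_def Let_def)
  then have "?ev F = ?ev (eval2 (\<lambda>c. [:[:c:]:]) F [:[:0, 1:]:] (1 - [:0, 1:] - [:[:0, 1:]:]))"
    by (rule arg_cong)
  also have "\<dots> = eval2 of_int F v (1 - u - v)"
    unfolding hom_eval2[OF const_const_hom eval2_hom[OF of_int_ring_hom]]
    by (simp only: hom_distribs ev.hom_one eval2_generators[OF of_int_ring_hom])
  finally show ?thesis by simp
qed

lemma elementary_symmetric_invariant:
  defines "U \<equiv> [:0, 1:]" and "V \<equiv> [:[:0, 1:]:]"
  shows "U * V + V * (1 - U - V) + (1 - U - V) * U \<in> C3_invariants"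
    and "U * V * (1 - U - V) \<in> C3_invariants"
proof -
  let ?g = "\<lambda>F. eval2 (\<lambda>c::int. [:[:c:]:]) F V (1 - U - V)"
  interpret g: comm_ring_hom ?g by (rule eval2_hom[OF const_const_hom])
  have gen: "?g U = V" "?g V = 1 - U - V"
    unfolding U_def V_def by (rule eval2_generators[OF const_const_hom])+
  have "?g (U * V + V * (1 - U - V) + (1 - U - V) * U) = U * V + V * (1 - U - V) + (1 - U - V) * U"
    unfolding g.hom_mult g.hom_add g.hom_minus g.hom_one gen
    by (simp only: algebra_simps)
  moreover have "?g (U * V * (1 - U - V)) = U * V * (1 - U - V)"
    unfolding g.hom_mult g.hom_add g.hom_minus g.hom_one gen by (simp only: algebra_simps)
  ultimately show "U * V + V * (1 - U - V) + (1 - U - V) * U \<in> C3_invariants"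
    "U * V * (1 - U - V) \<in> C3_invariants"
    unfolding C3_invariants_def Let_def U_def[symmetric] V_def[symmetric] by simp_all
qed

lemma value_at_orbit:
  assumes "f (Y, Z, X) = f (X, Y, Z)" "f (Z, X, Y) = f (X, Y, Z)"
  shows "value_at (C3_orbit (X, Y, Z)) f = f (X, Y, Z)"
proof -
  have "f ` C3_orbit (X, Y, Z) = {f (X, Y, Z)}"
    using assms by (simp add: C3_orbit_def)
  then show ?thesis by (simp add: value_at_def)
qed

lemma D0_integral_iff:
  assumes sum: "X + Y + Z = 1"
  shows "D0_integral (C3_orbit (X, Y, Z)) \<longleftrightarrow> (\<forall>F\<in>C3_invariants. eval2 of_int F X Y \<in> \<int>)"
proof -
  have "value_at (C3_orbit (X, Y, Z))
      (\<lambda>(X, Y, Z). eval2 of_int F (X / aug (X, Y, Z)) (Y / aug (X, Y, Z))) = eval2 of_int F X Y"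
    if "F \<in> C3_invariants" for F
  proof -
    have aug: "aug (X, Y, Z) = 1" "aug (Y, Z, X) = 1" "aug (Z, X, Y) = 1"
      using sum by (simp_all add: aug_def add_ac)
    have Z: "1 - X - Y = Z" and X: "1 - Y - Z = X" using sum by (simp_all add: algebra_simps)
    have "eval2 of_int F Y Z = eval2 of_int F X Y" "eval2 of_int F Z X = eval2 of_int F Y Z"
      using eval2_invariant[OF that, of Y X] eval2_invariant[OF that, of Z Y] Z X by simp_all
    then show ?thesis by (subst value_at_orbit) (simp_all add: aug)
  qed
  then show ?thesis by (simp add: D0_integral_def)
qed

text \<open>If \<open>r = p / q\<close> in lowest terms, the hypothesis says that every power of \<open>q\<close> divides \<open>D\<close>.\<close>

lemma rat_integral_of_bounded_denominators:
  fixes r :: rat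
  assumes "D > 0" "\<And>n. of_int D * r ^ n \<in> \<int>"
  shows "r \<in> \<int>"
proof -
  obtain p q where r: "quotient_of r = (p, q)" by (cases "quotient_of r")
  have q: "q > 0" and cop: "coprime p q" and eq: "r = of_int p / of_int q"
    using quotient_of_denom_pos[OF r] quotient_of_coprime[OF r] quotient_of_div[OF r] .
  have "q ^ n dvd D" for n
  proof -
    obtain k where "of_int D * r ^ n = of_int k" using assms(2) by (auto elim: Ints_cases)
    then have "rat_of_int (D * p ^ n) = of_int (k * q ^ n)"
      using q by (simp add: eq power_divide field_simps)
    then have "D * p ^ n = k * q ^ n" by (simp only: of_int_eq_iff)
    then have "q ^ n dvd D * p ^ n" by simp
    moreover have "coprime (q ^ n) (p ^ n)" using cop by (simp add: coprime_commute)
    ultimately show ?thesis by (simp add: coprime_dvd_mult_left_iff)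
  qed
  then have le: "q ^ nat D \<le> D" using assms(1) zdvd_imp_le by blast
  have "\<not> q \<ge> 2"
  proof
    assume "q \<ge> 2"
    then have "(2::int) ^ nat D \<le> q ^ nat D" by (simp add: power_mono)
    moreover have "int (nat D) < 2 ^ nat D" by (rule of_nat_less_two_power)
    ultimately show False using le assms(1) by simp
  qed
  with q have "q = 1" by simp
  then show ?thesis by (simp add: eq)
qed

context normal_cubic_algebra begin

interpretation Z: Modules.module "\<lambda>(c::int) y. of_int c * (y :: 'k)"
  by unfold_locales (simp_all add: algebra_simps)

text \<open>The lattice spanned by the normal basis. A rational number belongs to it only if it is an integer,
  because all its coordinates are equal to that number.\<close>

definition conj_lattice :: "'k set" where
  "conj_lattice = Z.span {x, \<sigma> x, \<sigma> (\<sigma> x)}"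

text \<open>For integral \<open>a\<close> and \<open>b\<close> this lattice is the ring generated by \<open>x\<close> and \<open>\<sigma> (\<sigma> x)\<close>, since the cubic
  equation reduces all higher powers.\<close>

definition order_lattice :: "'k set" where
  "order_lattice = Z.span {x ^ i * \<sigma> (\<sigma> x) ^ j | i j. i < 3 \<and> j < 3}"

lemma order_lattice_mult:
  assumes ab: "coeff_a \<in> \<int>" "coeff_b \<in> \<int>" and y: "y \<in> order_lattice"
  shows "x * y \<in> order_lattice" and "\<sigma> (\<sigma> x) * y \<in> order_lattice"
proof -
  obtain a b where "coeff_a = of_int a" "coeff_b = of_int b"
    using ab by (auto elim!: Ints_cases)
  then have root: "z ^ 3 = z ^ 2 - of_int a * z - of_int b" if "z = x \<or> z = \<sigma> (\<sigma> x)" for z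
    using cubic_factors[of z] that by (auto simp: algebra_simps)
  let ?w = "\<sigma> (\<sigma> x)"
  have base: "x ^ i * ?w ^ j \<in> order_lattice" if "i < 3" "j < 3" for i j
    unfolding order_lattice_def using that by (intro Z.span_base) blast
  have sub: "c - of_int a * d - of_int b * e \<in> order_lattice"
    if "c \<in> order_lattice" "d \<in> order_lattice" "e \<in> order_lattice" for c d e
    using that unfolding order_lattice_def by (intro Z.span_diff Z.span_scale)
  have step: "z * g \<in> order_lattice"
    if z: "z = x \<or> z = ?w" and g: "g \<in> {x ^ i * ?w ^ j | i j. i < 3 \<and> j < 3}" for z g
  proof -
    obtain i j where ij: "g = x ^ i * ?w ^ j" "i < 3" "j < 3" using g by blast
    show ?thesis
    proof (cases "z = x")
      case True
      show ?thesis
      proof (cases "i = 2")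
        case True
        then have "z * g = (z ^ 3) * ?w ^ j"
          by (simp add: ij \<open>z = x\<close> power3_eq_cube power2_eq_square ac_simps)
        also have "\<dots> = x ^ 2 * ?w ^ j - of_int a * (x ^ 1 * ?w ^ j) - of_int b * (x ^ 0 * ?w ^ j)"
          unfolding root[OF z] by (simp add: \<open>z = x\<close> algebra_simps)
        finally show ?thesis using ij by (simp only:) (intro sub base; simp)
      next
        case False
        then have "z * g = x ^ Suc i * ?w ^ j" by (simp add: ij \<open>z = x\<close> ac_simps)
        then show ?thesis using False ij by (simp only:) (intro base; simp)
      qed
    next
      case False
      with z have z': "z = ?w" by simp
      show ?thesis
      proof (cases "j = 2")
        case True
        then have "z * g = x ^ i * (z ^ 3)"
          by (simp add: ij z' power3_eq_cube power2_eq_square ac_simps)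
        also have "\<dots> = x ^ i * ?w ^ 2 - of_int a * (x ^ i * ?w ^ 1) - of_int b * (x ^ i * ?w ^ 0)"
          unfolding root[OF z] by (simp add: z' algebra_simps)
        finally show ?thesis using ij by (simp only:) (intro sub base; simp)
      next
        case False
        then have "z * g = x ^ i * ?w ^ Suc j" by (simp add: ij z' ac_simps)
        then show ?thesis using False ij by (simp only:) (intro base; simp)
      qed
    qed
  qed
  have "z * y \<in> order_lattice" if "z = x \<or> z = ?w" for z
    using y unfolding order_lattice_def
  proof (rule Z.span_induct)
    show "Z.subspace {y. z * y \<in> Z.span {x ^ i * ?w ^ j | i j. i < 3 \<and> j < 3}}"
      by (rule Z.subspaceI)
        (simp_all add: Z.span_zero distrib_left Z.span_add Z.span_scale mult.left_commute[of z])
  qed (use step[OF that] in \<open>simp only: order_lattice_def\<close>)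
  then show "x * y \<in> order_lattice" and "?w * y \<in> order_lattice" by simp_all
qed

lemma eval2_in_order_lattice:
  assumes ab: "coeff_a \<in> \<int>" "coeff_b \<in> \<int>"
  shows "eval2 of_int F x (\<sigma> (\<sigma> x)) \<in> order_lattice"
proof -
  have add: "y + z \<in> order_lattice" if "y \<in> order_lattice" "z \<in> order_lattice" for y z
    using that unfolding order_lattice_def by (rule Z.span_add)
  have zero: "0 \<in> order_lattice" unfolding order_lattice_def by (rule Z.span_zero)
  have int: "of_int c \<in> order_lattice" for c
  proof -
    have "x ^ 0 * \<sigma> (\<sigma> x) ^ 0 \<in> {x ^ i * \<sigma> (\<sigma> x) ^ j | i j. i < 3 \<and> j < 3}"
      by (rule CollectI, rule exI[of _ 0], rule exI[of _ 0]) simp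
    from Z.span_scale[OF Z.span_base[OF this]]
    have "of_int c * (x ^ 0 * \<sigma> (\<sigma> x) ^ 0) \<in> order_lattice"
      unfolding order_lattice_def .
    then show ?thesis by simp
  qed
  have "poly (map_poly of_int p) (\<sigma> (\<sigma> x)) \<in> order_lattice" for p :: "int poly"
    by (induction p) (simp_all add: map_poly_pCons zero add int order_lattice_mult[OF ab])
  then show ?thesis
    unfolding eval2_def
    by (induction F) (simp_all add: map_poly_pCons zero add order_lattice_mult[OF ab])
qed

lemma conj_lattice_scale: "y \<in> conj_lattice \<Longrightarrow> of_int n * y \<in> conj_lattice"
  unfolding conj_lattice_def by (rule Z.span_scale)

lemma denominator_exists: "\<exists>D>0. of_int D * y \<in> conj_lattice"
proof -
  have add: "\<exists>D>0. of_int D * (y + z) \<in> conj_lattice"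
    if y: "\<exists>D>0. of_int D * y \<in> conj_lattice" and z: "\<exists>D>0. of_int D * z \<in> conj_lattice" for y z
  proof -
    obtain D where D: "D > 0" "of_int D * y \<in> conj_lattice" using y by blast
    obtain E where E: "E > 0" "of_int E * z \<in> conj_lattice" using z by blast
    have "of_int E * (of_int D * y) + of_int D * (of_int E * z) \<in> conj_lattice"
      using conj_lattice_scale[OF D(2), of E] conj_lattice_scale[OF E(2), of D]
      unfolding conj_lattice_def by (rule Z.span_add)
    also have "of_int E * (of_int D * y) + of_int D * (of_int E * z) = of_int (D * E) * (y + z)"
      by (simp add: algebra_simps)
    finally show ?thesis using D(1) E(1) by (intro exI[of _ "D * E"]) simp
  qed
  have scale: "\<exists>D>0. of_int D * (\<iota> p * g) \<in> conj_lattice" if "g \<in> {x, \<sigma> x, \<sigma> (\<sigma> x)}" for p g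
  proof -
    obtain m n where q: "quotient_of p = (m, n)" by (cases "quotient_of p")
    have n: "n > 0" "p = of_int m / of_int n"
      using quotient_of_denom_pos[OF q] quotient_of_div[OF q] .
    have "of_int n * p = of_int m" unfolding n(2) using n(1) by simp
    from arg_cong[OF this, of \<iota>] have "of_int n * (\<iota> p * g) = of_int m * g"
      unfolding \<iota>_mult \<iota>_of_int mult.assoc[symmetric] by (rule arg_cong)
    also have "\<dots> \<in> conj_lattice"
      unfolding conj_lattice_def by (rule Z.span_scale[OF Z.span_base[OF that]])
    finally show ?thesis using n(1) by (intro exI[of _ n] conjI)
  qed
  obtain p q r where y: "y = \<iota> p * x + \<iota> q * \<sigma> x + \<iota> r * \<sigma> (\<sigma> x)"
    using spanning[of y] by (auto simp: sc_eq)
  show ?thesis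
    unfolding y by (rule add[OF add[OF scale scale] scale]) simp_all
qed

text \<open>It suffices to treat the nine generators of \<open>order_lattice\<close>.\<close>

lemma common_denominator: "\<exists>D>0. \<forall>y\<in>order_lattice. of_int D * y \<in> conj_lattice"
proof -
  have fin: "\<exists>D>0. \<forall>y\<in>G. of_int D * y \<in> conj_lattice" if "finite G" for G
    using that
  proof induction
    case (insert g G)
    from insert.IH obtain D where D: "D > 0" "\<forall>y\<in>G. of_int D * y \<in> conj_lattice" by blast
    from denominator_exists[of g] obtain E where E: "E > 0" "of_int E * g \<in> conj_lattice" by blast
    have "of_int (D * E) * y \<in> conj_lattice" if "y \<in> insert g G" for y
    proof (cases "y = g")
      case True
      show ?thesis unfolding True of_int_mult mult.assoc by (rule conj_lattice_scale[OF E(2)])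
    next
      case False
      with that have "y \<in> G" by simp
      from conj_lattice_scale[OF bspec[OF D(2) this], of E]
      show ?thesis by (simp add: ac_simps)
    qed
    then show ?case using mult_pos_pos[OF D(1) E(1)] by (intro exI[of _ "D * E"] conjI ballI)
  next
    case empty
    show ?case by (rule exI[of _ 1]) simp
  qed
  have "finite {x ^ i * \<sigma> (\<sigma> x) ^ j | i j. i < 3 \<and> j < 3}"
    by (rule finite_image_set2) simp_all
  from fin[OF this] obtain D where D: "D > 0"
    "\<And>g. g \<in> {x ^ i * \<sigma> (\<sigma> x) ^ j | i j. i < 3 \<and> j < 3} \<Longrightarrow> of_int D * g \<in> conj_lattice"
    by blast
  have "of_int D * y \<in> conj_lattice" if "y \<in> order_lattice" for y
    using that unfolding order_lattice_def
  proof (rule Z.span_induct)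
    show "Z.subspace {y. of_int D * y \<in> conj_lattice}"
    proof (rule Z.subspaceI; unfold mem_Collect_eq)
      show "of_int D * 0 \<in> conj_lattice" by (simp add: conj_lattice_def Z.span_zero)
    next
      fix y z assume "of_int D * y \<in> conj_lattice" "of_int D * z \<in> conj_lattice"
      then show "of_int D * (y + z) \<in> conj_lattice"
        unfolding conj_lattice_def distrib_left by (rule Z.span_add)
    next
      fix c y assume "of_int D * y \<in> conj_lattice"
      from conj_lattice_scale[OF this] show "of_int D * (of_int c * y) \<in> conj_lattice"
        unfolding mult.left_commute[of "of_int D"] .
    qed
  qed (use D(2) in blast)
  with D(1) show ?thesis by blast
qed

lemma rational_in_conj_lattice:
  assumes "\<iota> r \<in> conj_lattice" shows "r \<in> \<int>"
proof -
  obtain l m n where "\<iota> r - of_int l * x - of_int m * \<sigma> x - of_int n * \<sigma> (\<sigma> x) = 0"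
    using assms by (auto simp: conj_lattice_def Z.span_breakdown_eq)
  then have r: "\<iota> r = \<iota> (of_int l) * x + \<iota> (of_int m) * \<sigma> x + \<iota> (of_int n) * \<sigma> (\<sigma> x)"
    unfolding \<iota>_of_int diff_diff_eq right_minus_eq .
  have "\<iota> r * x + \<iota> r * \<sigma> x + \<iota> r * \<sigma> (\<sigma> x) = \<iota> r * (x + \<sigma> x + \<sigma> (\<sigma> x))"
    by (simp only: distrib_left)
  also have "\<dots> = \<iota> r" by (simp add: trace)
  also note r
  finally have "\<iota> r * x + \<iota> r * \<sigma> x + \<iota> r * \<sigma> (\<sigma> x) =
    \<iota> (of_int l) * x + \<iota> (of_int m) * \<sigma> x + \<iota> (of_int n) * \<sigma> (\<sigma> x)" .
  from coordinates_unique[OF this] have "r = of_int l" by blast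
  then show ?thesis by simp
qed

text \<open>The value \<open>r\<close> is rational since it is fixed by \<open>\<sigma>\<close>. Its powers are values of powers of \<open>F\<close>, hence lie
  in \<open>order_lattice\<close>, and a single denominator brings all of them into \<open>conj_lattice\<close>.\<close>

lemma invariant_integral:
  assumes ab: "coeff_a \<in> \<int>" "coeff_b \<in> \<int>" and F: "F \<in> C3_invariants"
  shows "\<exists>n. eval2 of_int F x (\<sigma> (\<sigma> x)) = of_int n"
proof -
  let ?y = "eval2 of_int F x (\<sigma> (\<sigma> x))"
  have hom: "comm_ring_hom \<sigma>" by unfold_locales simp_all
  have \<sigma>_int: "\<sigma> (of_int n) = of_int n" for n using \<sigma>_\<iota>[of "of_int n"] by simp
  have "\<sigma> ?y = eval2 of_int F (\<sigma> x) x"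
    unfolding hom_eval2[OF of_int_ring_hom hom] by (simp only: \<sigma>_int \<sigma>_cubed)
  also have "1 - \<sigma> x - x = \<sigma> (\<sigma> x)" using trace by (simp add: algebra_simps)
  then have "eval2 of_int F (\<sigma> x) x = ?y"
    using eval2_invariant[OF F, of x "\<sigma> x"] by simp
  finally obtain r where r: "?y = \<iota> r" by (rule fixed_rational)
  obtain D where D: "D > 0" "\<And>y. y \<in> order_lattice \<Longrightarrow> of_int D * y \<in> conj_lattice"
    using common_denominator by blast
  have "of_int D * r ^ n \<in> \<int>" for n
  proof -
    interpret ev: comm_ring_hom "\<lambda>F. eval2 of_int F x (\<sigma> (\<sigma> x))"
      by (rule eval2_hom[OF of_int_ring_hom])
    have "\<iota> (r ^ n) = eval2 of_int (F ^ n) x (\<sigma> (\<sigma> x))"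
      by (simp only: ev.hom_power r \<iota>_power)
    then have "\<iota> (r ^ n) \<in> order_lattice"
      using eval2_in_order_lattice[OF ab] by simp
    from D(2)[OF this] have "\<iota> (of_int D * r ^ n) \<in> conj_lattice" by simp
    then show ?thesis by (rule rational_in_conj_lattice)
  qed
  with D(1) have "r \<in> \<int>" by (rule rat_integral_of_bounded_denominators)
  then show ?thesis unfolding r by (auto elim!: Ints_cases)
qed

end

context embedded_normal_cubic_algebra begin

lemma D0_integral_iff_coeffs:
  "D0_integral (C3_orbit (\<tau> x, \<tau> (\<sigma> (\<sigma> x)), \<tau> (\<sigma> x))) \<longleftrightarrow> coeff_a \<in> \<int> \<and> coeff_b \<in> \<int>"
proof -
  have sum: "\<tau> x + \<tau> (\<sigma> (\<sigma> x)) + \<tau> (\<sigma> x) = 1" using conjugates_sum by (simp add: add_ac)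
  have hom: "comm_ring_hom \<tau>" by unfold_locales simp_all
  have \<tau>_int: "\<tau> (of_int n) = of_int n" for n using \<tau>_\<iota>[of "of_int n"] by simp
  have ev: "eval2 of_int F (\<tau> x) (\<tau> (\<sigma> (\<sigma> x))) = \<tau> (eval2 of_int F x (\<sigma> (\<sigma> x)))" for F
    unfolding hom_eval2[OF of_int_ring_hom hom] by (simp only: \<tau>_int)
  have int: "c \<in> \<int>" if "complex_of_rat c \<in> \<int>" for c
    using that by (metis Ints_cases Ints_of_int of_rat_eq_iff of_rat_of_int_eq)
  show ?thesis unfolding D0_integral_iff[OF sum]
  proof
    assume R: "\<forall>F\<in>C3_invariants. eval2 of_int F (\<tau> x) (\<tau> (\<sigma> (\<sigma> x))) \<in> \<int>"
    let ?ev = "\<lambda>F. eval2 of_int F (\<tau> x) (\<tau> (\<sigma> (\<sigma> x)))"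
    interpret ev: comm_ring_hom ?ev by (rule eval2_hom[OF of_int_ring_hom])
    have Z: "1 - \<tau> x - \<tau> (\<sigma> (\<sigma> x)) = \<tau> (\<sigma> x)" using sum by (simp add: algebra_simps)
    note hom_simps = ev.hom_add ev.hom_mult ev.hom_minus ev.hom_one
      eval2_generators[OF of_int_ring_hom] Z
    have "\<tau> x * \<tau> (\<sigma> (\<sigma> x)) + \<tau> (\<sigma> (\<sigma> x)) * \<tau> (\<sigma> x) + \<tau> (\<sigma> x) * \<tau> x \<in> \<int>"
      using bspec[OF R elementary_symmetric_invariant(1)] unfolding hom_simps .
    then have "complex_of_rat coeff_a \<in> \<int>"
      unfolding conjugates_sum2[symmetric] by (simp add: ac_simps)
    moreover have "\<tau> x * \<tau> (\<sigma> (\<sigma> x)) * \<tau> (\<sigma> x) \<in> \<int>"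
      using bspec[OF R elementary_symmetric_invariant(2)] unfolding hom_simps .
    then have "- complex_of_rat coeff_b \<in> \<int>"
      unfolding conjugates_prod[symmetric] by (simp add: ac_simps)
    ultimately show "coeff_a \<in> \<int> \<and> coeff_b \<in> \<int>" using int by simp
  next
    assume ab: "coeff_a \<in> \<int> \<and> coeff_b \<in> \<int>"
    show "\<forall>F\<in>C3_invariants. eval2 of_int F (\<tau> x) (\<tau> (\<sigma> (\<sigma> x))) \<in> \<int>"
    proof
      fix F assume "F \<in> C3_invariants"
      then obtain n where "eval2 of_int F x (\<sigma> (\<sigma> x)) = of_int n" using invariant_integral ab by blast
      then show "eval2 of_int F (\<tau> x) (\<tau> (\<sigma> (\<sigma> x))) \<in> \<int>" by (simp add: ev \<tau>_int)
    qed
  qed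
qed

end


section \<open>Places of the field of the cube roots of unity\<close>

lemma cnj_of_rat: "cnj (of_rat q) = of_rat q"
  by (cases q) (simp add: of_rat_rat)

text \<open>The exponent is an arbitrary integer and \<open>q\<close> may be \<open>0\<close>, the default cardinality of an infinite
  residue field; there \<open>ln 0 = 0\<close> makes both sides vanish.\<close>

lemma ln_of_nat_powi: "ln (real q powi n) = of_int n * ln (real q)"
proof (cases "q = 0")
  case True
  then show ?thesis by (simp add: power_int_0_left_if)
next
  case False
  then have "real q powi n = real q powr of_int n" by (simp add: powr_real_of_int')
  then show ?thesis using False by (simp add: ln_powr)
qed

locale primitive_cube_root =
  fixes \<zeta> :: complex
  assumes \<zeta>_cubed: "\<zeta> ^ 3 = 1" and \<zeta>_ne_1: "\<zeta> \<noteq> 1"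
begin

lemma \<zeta>_square: "\<zeta> * \<zeta> = - 1 - \<zeta>"
proof -
  have "(\<zeta> - 1) * (\<zeta> * \<zeta> + \<zeta> + 1) = \<zeta> ^ 3 - 1"
    by (simp add: algebra_simps power3_eq_cube)
  then have "\<zeta> * \<zeta> + \<zeta> + 1 = 0" using \<zeta>_cubed \<zeta>_ne_1 by simp
  then show ?thesis by (simp add: algebra_simps eq_neg_iff_add_eq_0)
qed

lemma \<zeta>_ne_0: "\<zeta> \<noteq> 0" using \<zeta>_cubed by auto

lemma cnj_\<zeta>: "cnj \<zeta> = \<zeta>\<^sup>2"
proof -
  have "cmod \<zeta> ^ 3 = 1" using \<zeta>_cubed by (metis norm_one norm_power)
  then have "cmod \<zeta> = 1" using power_eq_iff_eq_base[of 3 "cmod \<zeta>" 1] by simp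
  then have "\<zeta> * cnj \<zeta> = 1" by (simp add: complex_norm_square[symmetric])
  also have "\<dots> = \<zeta> * \<zeta>\<^sup>2" using \<zeta>_cubed by (simp add: power3_eq_cube power2_eq_square mult.assoc)
  finally show ?thesis using \<zeta>_ne_0 by simp
qed

lemma E_rat: "of_rat q \<in> E_field \<zeta>"
  unfolding E_field_def by (intro CollectI exI[of _ q] exI[of _ 0]) simp

lemma E_int: "of_int n \<in> E_field \<zeta>"
  using E_rat[of "of_int n"] by simp

lemma E_add: "y \<in> E_field \<zeta> \<Longrightarrow> z \<in> E_field \<zeta> \<Longrightarrow> y + z \<in> E_field \<zeta>"
proof -
  assume "y \<in> E_field \<zeta>" "z \<in> E_field \<zeta>"
  then obtain p q r s where "y = of_rat p + of_rat q * \<zeta>" "z = of_rat r + of_rat s * \<zeta>"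
    unfolding E_field_def by blast
  then have "y + z = of_rat (p + r) + of_rat (q + s) * \<zeta>"
    by (simp add: of_rat_add algebra_simps)
  then show ?thesis unfolding E_field_def by blast
qed

lemma E_mult: "y \<in> E_field \<zeta> \<Longrightarrow> z \<in> E_field \<zeta> \<Longrightarrow> y * z \<in> E_field \<zeta>"
proof -
  assume "y \<in> E_field \<zeta>" "z \<in> E_field \<zeta>"
  then obtain p q r s where yz: "y = of_rat p + of_rat q * \<zeta>" "z = of_rat r + of_rat s * \<zeta>"
    unfolding E_field_def by blast
  have "y * z = of_rat p * of_rat r + (of_rat p * of_rat s + of_rat q * of_rat r) * \<zeta> +
    of_rat q * of_rat s * (\<zeta> * \<zeta>)"
    by (simp add: yz algebra_simps)
  also have "\<dots> = of_rat (p * r - q * s) + of_rat (p * s + q * r - q * s) * \<zeta>"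
    unfolding \<zeta>_square by (simp add: of_rat_add of_rat_diff of_rat_mult algebra_simps)
  finally show ?thesis unfolding E_field_def by blast
qed

lemma E_inverse:
  assumes "y \<in> E_field \<zeta>" shows "inverse y \<in> E_field \<zeta>"
proof (cases "y = 0")
  case True
  then show ?thesis using E_rat[of 0] by simp
next
  case False
  obtain p q where y: "y = of_rat p + of_rat q * \<zeta>" using assms unfolding E_field_def by blast
  \<comment> \<open>The complex conjugate is the Galois conjugate, and the norm is rational.\<close>
  have cnj: "cnj y = of_rat (p - q) + of_rat (- q) * \<zeta>"
  proof -
    have "cnj y = of_rat p + of_rat q * (\<zeta> * \<zeta>)"
      by (simp add: y cnj_\<zeta> cnj_of_rat power2_eq_square)
    also have "\<dots> = of_rat (p - q) + of_rat (- q) * \<zeta>"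
      unfolding \<zeta>_square by (simp add: of_rat_diff of_rat_minus algebra_simps)
    finally show ?thesis .
  qed
  have "y * cnj y = of_rat p * of_rat (p - q) + (of_rat q * of_rat (p - q) + of_rat p * of_rat (- q)) * \<zeta>
      + of_rat q * of_rat (- q) * (\<zeta> * \<zeta>)"
    unfolding cnj by (simp add: y algebra_simps)
  also have "\<dots> = of_rat (p * p - p * q + q * q)"
    unfolding \<zeta>_square by (simp add: of_rat_add of_rat_diff of_rat_minus of_rat_mult algebra_simps)
  finally have norm: "y * cnj y = of_rat (p * p - p * q + q * q)" .
  have "inverse y = cnj y * inverse (y * cnj y)" using False by (simp add: field_simps)
  then have "inverse y = cnj y * of_rat (inverse (p * p - p * q + q * q))"
    unfolding norm of_rat_inverse .
  moreover have "cnj y \<in> E_field \<zeta>" unfolding cnj E_field_def by blast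
  ultimately show ?thesis using E_mult E_rat by simp
qed

lemma E_powi: "y \<in> E_field \<zeta> \<Longrightarrow> y powi n \<in> E_field \<zeta>"
proof -
  assume y: "y \<in> E_field \<zeta>"
  have "z ^ k \<in> E_field \<zeta>" if "z \<in> E_field \<zeta>" for z and k :: nat
    by (induction k) (use that E_mult E_rat[of 1] in auto)
  then show ?thesis unfolding power_int_def using y E_inverse by auto
qed

text \<open>Logarithms of absolute values turn all places alike into homomorphisms on the nonzero elements of the field.\<close>

definition log_abs :: "place \<Rightarrow> complex \<Rightarrow> real" where
  "log_abs w z = ln (place_abs \<zeta> w z)"

lemma valuation_mult:
  assumes "v \<in> normalized_valuations \<zeta>" "y \<in> E_field \<zeta>" "z \<in> E_field \<zeta>" "y \<noteq> 0" "z \<noteq> 0"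
  shows "v (y * z) = v y + v z"
  using assms unfolding normalized_valuations_def Let_def by auto

lemma valuation_add:
  assumes "v \<in> normalized_valuations \<zeta>" "y \<in> E_field \<zeta>" "z \<in> E_field \<zeta>" "y \<noteq> 0" "z \<noteq> 0" "y + z \<noteq> 0"
  shows "min (v y) (v z) \<le> v (y + z)"
  using assms unfolding normalized_valuations_def Let_def by auto

lemma valuation_1: "v \<in> normalized_valuations \<zeta> \<Longrightarrow> v 1 = 0"
  using valuation_mult[of v 1 1] E_rat[of 1] by simp

lemma valuation_uminus:
  assumes "v \<in> normalized_valuations \<zeta>" "z \<in> E_field \<zeta>" "z \<noteq> 0"
  shows "v (- z) = v z"
proof -
  have E: "- 1 \<in> E_field \<zeta>" using E_int[of "-1"] by simp
  have "v (- 1) + v (- 1) = 0"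
    using valuation_mult[OF assms(1) E E] valuation_1[OF assms(1)] by simp
  then have "v (- 1) = 0" by simp
  then show ?thesis using valuation_mult[OF assms(1) E assms(2)] assms(3) by simp
qed

lemma valuation_of_int_nonneg:
  assumes v: "v \<in> normalized_valuations \<zeta>" and "n \<noteq> 0"
  shows "0 \<le> v (of_int n)"
proof -
  have nat: "0 \<le> v (of_nat (Suc k))" for k
  proof (induction k)
    case (Suc k)
    have E: "of_nat (Suc k) \<in> E_field \<zeta>" using E_int[of "int (Suc k)"] by simp
    have eq: "of_nat (Suc k) + 1 = (of_nat (Suc (Suc k)) :: complex)" by simp
    have ne: "(of_nat (Suc k) :: complex) \<noteq> 0" "(of_nat (Suc (Suc k)) :: complex) \<noteq> 0"
      by (simp_all only: of_nat_eq_0_iff)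
    have "min (v (of_nat (Suc k))) (v 1) \<le> v (of_nat (Suc k) + 1)"
      by (rule valuation_add[OF v E]) (use E_rat[of 1] ne eq in simp_all)
    with Suc valuation_1[OF v] show ?case by (simp add: add.commute)
  qed (simp add: valuation_1[OF v])
  have "v (of_int n) = v (of_int \<bar>n\<bar>)"
    using valuation_uminus[OF v E_int] \<open>n \<noteq> 0\<close> by (simp add: abs_if)
  moreover have "of_int \<bar>n\<bar> = (of_nat (Suc (nat \<bar>n\<bar> - 1)) :: complex)"
    using \<open>n \<noteq> 0\<close> by (simp add: of_nat_diff)
  ultimately show ?thesis using nat by simp
qed

text \<open>If \<open>v z\<close> were negative, \<open>v (z z) = 2 v z\<close> would be smaller than the valuations of both terms on the
  right-hand side.\<close>

lemma valuation_integral_nonneg: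
  assumes v: "v \<in> normalized_valuations \<zeta>" and z: "z \<in> E_field \<zeta>" "z \<noteq> 0"
    and eq: "z * z = of_int s * z + of_int n" and "n \<noteq> 0"
  shows "0 \<le> v z"
proof (rule ccontr)
  assume neg: "\<not> 0 \<le> v z"
  have n: "0 \<le> v (of_int n)" by (rule valuation_of_int_nonneg) fact+
  have "min (v z) 0 \<le> v (z * z)"
  proof (cases "s = 0")
    case True
    then show ?thesis using n eq by simp
  next
    case False
    have "min (v (of_int s * z)) (v (of_int n)) \<le> v (of_int s * z + of_int n)"
      using False assms(5) z eq by (intro valuation_add[OF v] E_mult E_int) auto
    moreover have "v (of_int s * z) = v (of_int s) + v z"
      using False z by (intro valuation_mult[OF v] E_int) auto
    moreover have "0 \<le> v (of_int s)" by (rule valuation_of_int_nonneg) fact+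
    ultimately show ?thesis using n unfolding eq by linarith
  qed
  moreover have "v (z * z) = v z + v z" by (rule valuation_mult) fact+
  ultimately show False using neg by linarith
qed

lemma log_abs_mult:
  assumes "w \<in> places \<zeta>" "y \<in> E_field \<zeta>" "z \<in> E_field \<zeta>" "y \<noteq> 0" "z \<noteq> 0"
  shows "log_abs w (y * z) = log_abs w y + log_abs w z"
proof (cases w)
  case Infinite
  then show ?thesis using assms by (simp add: log_abs_def norm_mult power_mult_distrib ln_mult)
next
  case (Finite v)
  then have v: "v \<in> normalized_valuations \<zeta>" using assms(1) by (auto simp: places_def)
  then show ?thesis using assms Finite valuation_mult[OF v assms(2-)]
    by (simp add: log_abs_def ln_of_nat_powi algebra_simps)
qed

lemma log_abs_powi:
  assumes "w \<in> places \<zeta>" "z \<in> E_field \<zeta>" "z \<noteq> 0"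
  shows "log_abs w (z powi n) = of_int n * log_abs w z"
proof -
  have 1: "log_abs w 1 = 0"
    using log_abs_mult[OF assms(1), of 1 1] E_rat[of 1] by simp
  have pow: "log_abs w (y ^ k) = of_nat k * log_abs w y"
    if "y \<in> E_field \<zeta>" "y \<noteq> 0" for y and k :: nat
  proof (induction k)
    case (Suc k)
    have "y ^ k \<in> E_field \<zeta>" using E_powi[OF that(1), of "int k"] by simp
    then show ?case using that Suc log_abs_mult[OF assms(1), of y "y ^ k"] by (simp add: algebra_simps)
  qed (simp add: 1)
  have "log_abs w (z * inverse z) = log_abs w z + log_abs w (inverse z)"
    using assms E_inverse by (intro log_abs_mult) auto
  then have inv: "log_abs w (inverse z) = - log_abs w z" using assms(3) 1 by simp
  show ?thesis
  proof (cases "n \<ge> 0")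
    case True
    then show ?thesis using pow[OF assms(2,3), of "nat n"] by (simp add: power_int_def)
  next
    case False
    then show ?thesis using pow[of "inverse z" "nat (- n)"] assms E_inverse inv
      by (simp add: power_int_def)
  qed
qed

end


section \<open>Lagrange resolvents and the toric height\<close>

lemma resolvent_cube:
  fixes X Y Z \<omega> :: "'a::comm_ring_1"
  assumes "\<omega> ^ 3 = 1"
  shows "(X + \<omega> * Y + \<omega>\<^sup>2 * Z) ^ 3 =
    (X^3 + Y^3 + Z^3 + 6 * X * Y * Z) + \<omega> * (3 * (X^2 * Y + Y^2 * Z + Z^2 * X)) +
    \<omega>\<^sup>2 * (3 * (X * Y^2 + Y * Z^2 + Z * X^2))"
proof -
  have "(X + \<omega> * Y + \<omega>\<^sup>2 * Z) ^ 3 =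
    (X^3 + \<omega>^3 * Y^3 + \<omega>^3 * \<omega>^3 * Z^3 + 6 * \<omega>^3 * X * Y * Z) +
    \<omega> * (3 * (X^2 * Y + \<omega>^3 * Y^2 * Z + \<omega>^3 * Z^2 * X)) +
    \<omega>\<^sup>2 * (3 * (X * Y^2 + \<omega>^3 * Y * Z^2 + Z * X^2))"
    by (simp add: power2_eq_square power3_eq_cube algebra_simps)
  then show ?thesis unfolding assms by simp
qed

context primitive_cube_root begin

lemma resolvent_product:
  "(X + \<zeta> * Y + \<zeta>\<^sup>2 * Z) * (X + \<zeta>\<^sup>2 * Y + \<zeta> * Z) = (X + Y + Z)^2 - 3 * (X*Y + Y*Z + Z*X)"
proof -
  have "(X + \<zeta> * Y + \<zeta>\<^sup>2 * Z) * (X + \<zeta>\<^sup>2 * Y + \<zeta> * Z) =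
    X^2 + \<zeta>^3 * Y^2 + \<zeta>^3 * Z^2 + (\<zeta> + \<zeta> * \<zeta>) * (X*Y + Z*X) + (\<zeta>^3 * \<zeta> + \<zeta> * \<zeta>) * (Y*Z)"
    by (simp add: power2_eq_square power3_eq_cube algebra_simps)
  also have "\<dots> = (X + Y + Z)^2 - 3 * (X*Y + Y*Z + Z*X)"
    unfolding \<zeta>_cubed \<zeta>_square by (simp add: power2_eq_square algebra_simps)
  finally show ?thesis .
qed

text \<open>A cyclic permutation of the coordinates multiplies the resolvents by \<open>\<zeta>\<^sup>2\<close> and \<open>\<zeta>\<close>, hence the character
  by \<open>\<zeta>\<close> to the power \<open>2 m\<^sub>1 + m\<^sub>2\<close>. This exponent is a multiple of three on the character lattice of the quotient.\<close>

lemma character_rotate: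
  assumes "m \<in> char_lattice" "X + Y + Z = 1"
  shows "character \<zeta> m (Y, Z, X) = character \<zeta> m (X, Y, Z)"
proof -
  obtain r s where m: "m = (2 * r - s, 2 * s - r)" using assms(1) by (auto simp: char_lattice_def)
  have "Y + \<zeta> * Z + \<zeta>\<^sup>2 * X = \<zeta>\<^sup>2 * X + \<zeta>^3 * Y + \<zeta> * \<zeta>^3 * Z"
    by (simp add: \<zeta>_cubed)
  then have y1: "Y + \<zeta> * Z + \<zeta>\<^sup>2 * X = \<zeta>\<^sup>2 * (X + \<zeta> * Y + \<zeta>\<^sup>2 * Z)"
    by (simp add: power2_eq_square power3_eq_cube algebra_simps)
  have "Y + \<zeta>\<^sup>2 * Z + \<zeta> * X = \<zeta> * X + \<zeta>^3 * Y + \<zeta>\<^sup>2 * Z" by (simp add: \<zeta>_cubed)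
  then have y2: "Y + \<zeta>\<^sup>2 * Z + \<zeta> * X = \<zeta> * (X + \<zeta>\<^sup>2 * Y + \<zeta> * Z)"
    by (simp add: power2_eq_square power3_eq_cube algebra_simps)
  have "(\<zeta>\<^sup>2) powi fst m * \<zeta> powi snd m = \<zeta> powi (2 * fst m) * \<zeta> powi snd m"
    by (simp add: power_int_mult)
  also have "\<dots> = \<zeta> powi (2 * fst m + snd m)" using \<zeta>_ne_0 by (simp add: power_int_add)
  also have "\<dots> = (\<zeta> ^ 3) powi r" by (simp add: m power_int_mult)
  finally have "(\<zeta>\<^sup>2) powi fst m * \<zeta> powi snd m = 1" by (simp add: \<zeta>_cubed)
  moreover have "aug (X, Y, Z) = 1" "aug (Y, Z, X) = 1" using assms(2) by (simp_all add: aug_def add_ac)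
  ultimately show ?thesis
    unfolding character_def split y1 y2
    by (simp add: power_int_mult_distrib)
qed

lemma value_at_character:
  assumes "m \<in> char_lattice" "X + Y + Z = 1"
  shows "value_at (C3_orbit (X, Y, Z)) (character \<zeta> m) =
    (X + \<zeta> * Y + \<zeta>\<^sup>2 * Z) powi fst m * (X + \<zeta>\<^sup>2 * Y + \<zeta> * Z) powi snd m"
proof -
  have "Y + Z + X = 1" using assms(2) by (simp add: add_ac)
  then have "value_at (C3_orbit (X, Y, Z)) (character \<zeta> m) = character \<zeta> m (X, Y, Z)"
    using character_rotate[OF assms] character_rotate[OF assms(1), of Y Z X]
    by (intro value_at_orbit) simp_all
  then show ?thesis using assms(2) by (simp add: character_def aug_def)
qed

text \<open>The logarithms of \<open>y\<^sub>1\<^sup>3\<close> and \<open>y\<^sub>2\<^sup>3\<close> determine the image of the point in the cocharacter space, although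
  the resolvents themselves need not lie in the field generated by \<open>\<zeta>\<close>. The finite places contribute
  nothing because the two cubes are integral, and the infinite place contributes equally through both
  cubes because they are complex conjugates.\<close>

lemma D0_height_orbit:
  assumes sum: "X + Y + Z = 1"
    and e2: "X * Y + Y * Z + Z * X = of_int a" and e3: "X * Y * Z = - of_int b"
    and A: "X^3 + Y^3 + Z^3 + 6 * X * Y * Z = of_rat A"
    and B: "3 * (X^2 * Y + Y^2 * Z + Z^2 * X) = of_rat B"
    and C: "3 * (X * Y^2 + Y * Z^2 + Z * X^2) = of_rat C"
    and pos: "1 - 3 * a > 0"
  shows "D0_height \<zeta> (C3_orbit (X, Y, Z)) = sqrt (1 - 3 * of_int a)"
proof -
  define P where "P = C3_orbit (X, Y, Z)"
  define N where "N = 1 - 3 * a"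
  define y1 y2 where "y1 = X + \<zeta> * Y + \<zeta>\<^sup>2 * Z" and "y2 = X + \<zeta>\<^sup>2 * Y + \<zeta> * Z"
  have N: "N \<ge> 1" using pos by (simp add: N_def)
  have y12: "y1 * y2 = of_int N"
    unfolding y1_def y2_def resolvent_product sum e2 by (simp add: N_def)
  then have ne: "y1 \<noteq> 0" "y2 \<noteq> 0" using N by auto
  have w1: "y1 ^ 3 = of_rat A + \<zeta> * of_rat B + \<zeta>\<^sup>2 * of_rat C"
    unfolding y1_def resolvent_cube[OF \<zeta>_cubed] A B C ..
  have "(\<zeta>\<^sup>2) ^ 3 = (\<zeta> ^ 3) ^ 2" by (simp add: power_mult[symmetric])
  then have \<omega>: "(\<zeta>\<^sup>2) ^ 3 = 1" by (simp add: \<zeta>_cubed)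
  have "(\<zeta>\<^sup>2)\<^sup>2 = \<zeta> ^ 3 * \<zeta>" by (simp add: power2_eq_square power3_eq_cube)
  then have \<omega>2: "(\<zeta>\<^sup>2)\<^sup>2 = \<zeta>" by (simp add: \<zeta>_cubed)
  have w2: "y2 ^ 3 = of_rat A + \<zeta>\<^sup>2 * of_rat B + \<zeta> * of_rat C"
    using resolvent_cube[OF \<omega>, of X Y Z] unfolding \<omega>2 A B C y2_def .
  have cnj: "cnj (y1 ^ 3) = y2 ^ 3"
    unfolding w1 w2 by (simp add: cnj_of_rat cnj_\<zeta> \<omega>2[simplified])
  have \<zeta>_E: "\<zeta> \<in> E_field \<zeta>"
    unfolding E_field_def by (intro CollectI exI[of _ 0] exI[of _ 1]) simp
  have E: "y1 ^ 3 \<in> E_field \<zeta>" "y2 ^ 3 \<in> E_field \<zeta>"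
    unfolding w1 w2 power2_eq_square by (intro E_add E_mult E_rat \<zeta>_E)+
  have w_prod: "y1 ^ 3 * y2 ^ 3 = of_int (N ^ 3)"
    by (simp add: power_mult_distrib[symmetric] y12)
  have "y1 ^ 3 + y2 ^ 3 = 2 * of_rat A + (\<zeta> + \<zeta> * \<zeta>) * of_rat B + (\<zeta> + \<zeta> * \<zeta>) * of_rat C"
    unfolding w1 w2 by (simp add: power2_eq_square algebra_simps)
  also have "\<dots> = 2 * of_rat A - of_rat B - of_rat C"
    unfolding \<zeta>_square by simp
  also have "\<dots> = 2 * (X+Y+Z)^3 - 9 * (X+Y+Z) * (X*Y+Y*Z+Z*X) + 27 * (X * Y * Z)"
    using norm_form_cubed(2)[of X Y Z] unfolding A B C by (simp add: mult.assoc)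
  also have "\<dots> = of_int (2 - 9 * a - 27 * b)"
    unfolding sum e2 e3 by simp
  finally have w_sum: "y1 ^ 3 + y2 ^ 3 = of_int (2 - 9 * a - 27 * b)" .
  have log_point: "log_point \<zeta> w P = (- log_abs w (y1 ^ 3) / 3, - log_abs w (y2 ^ 3) / 3)"
    if w: "w \<in> places \<zeta>" for w
  proof -
    let ?l1 = "log_abs w (y1 ^ 3)" and ?l2 = "log_abs w (y2 ^ 3)"
    \<comment> \<open>The characters of the quotient torus are powers of \<open>y\<^sub>1\<^sup>3 / N\<close> and \<open>y\<^sub>2\<^sup>3 / N\<close>,
      as \<open>y\<^sub>1\<^sup>2 / y\<^sub>2 = y\<^sub>1\<^sup>3 / (y\<^sub>1 y\<^sub>2)\<close>.\<close>
    have lN: "3 * log_abs w (of_int N) = ?l1 + ?l2"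
    proof -
      have "3 * log_abs w (of_int N) = log_abs w (of_int N powi 3)"
        using log_abs_powi[OF w E_int, of N 3] N by simp
      also have "of_int N powi 3 = y1 ^ 3 * y2 ^ 3" by (simp add: w_prod)
      also have "log_abs w \<dots> = ?l1 + ?l2" using ne by (intro log_abs_mult w E) simp_all
      finally show ?thesis .
    qed
    have val: "log_abs w (value_at P (character \<zeta> (2 * r - s, 2 * s - r))) =
      (of_int (2 * r - s) * ?l1 + of_int (2 * s - r) * ?l2) / 3" for r s
    proof -
      have E_N: "inverse (of_int N) \<in> E_field \<zeta>" by (intro E_inverse E_int)
      have N0: "inverse (of_int N :: complex) \<noteq> 0" using N by simp
      have lN': "log_abs w (inverse (of_int N)) = - log_abs w (of_int N)"
        using log_abs_powi[OF w E_int, of N "-1"] N by (simp add: power_int_minus)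
      have "(2 * r - s, 2 * s - r) \<in> char_lattice" by (auto simp: char_lattice_def)
      then have "value_at P (character \<zeta> (2 * r - s, 2 * s - r)) = y1 powi (2 * r - s) * y2 powi (2 * s - r)"
        unfolding P_def using sum by (simp add: value_at_character y1_def y2_def)
      also have "\<dots> = (y1 powi 2 * inverse y2) powi r * (y2 powi 2 * inverse y1) powi s"
        using ne by (simp add: power_int_diff power_int_mult power_int_mult_distrib power_int_inverse divide_inverse)
      also have "y1 powi 2 * inverse y2 = y1 ^ 3 * inverse (of_int N)"
        using ne by (simp add: y12[symmetric] power2_eq_square power3_eq_cube)
      also have "y2 powi 2 * inverse y1 = y2 ^ 3 * inverse (of_int N)"
        using ne by (simp add: y12[symmetric] power2_eq_square power3_eq_cube)
      also have "log_abs w ((y1 ^ 3 * inverse (of_int N)) powi r * (y2 ^ 3 * inverse (of_int N)) powi s) =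
        of_int r * (?l1 - log_abs w (of_int N)) + of_int s * (?l2 - log_abs w (of_int N))"
        using ne N0 E E_N by (simp add: log_abs_mult[OF w] log_abs_powi[OF w] E_mult E_powi lN')
      also have "\<dots> = (of_int (2 * r - s) * ?l1 + of_int (2 * s - r) * ?l2) / 3"
      proof -
        have "log_abs w (of_int N) = (?l1 + ?l2) / 3" using lN by simp
        then show ?thesis by (simp add: field_simps)
      qed
      finally show ?thesis .
    qed
    show ?thesis unfolding log_point_def
    proof (rule the_equality)
      show "\<forall>m\<in>char_lattice. pairing m (- ?l1 / 3, - ?l2 / 3) =
        - ln (place_abs \<zeta> w (value_at P (character \<zeta> m)))"
      proof
        fix m assume "m \<in> char_lattice"
        then obtain r s where m: "m = (2 * r - s, 2 * s - r)" by (auto simp: char_lattice_def)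
        show "pairing m (- ?l1 / 3, - ?l2 / 3) = - ln (place_abs \<zeta> w (value_at P (character \<zeta> m)))"
          using val[of r s] unfolding log_abs_def m pairing_def by (simp add: field_simps)
      qed
    next
      fix n assume n: "\<forall>m\<in>char_lattice. pairing m n = - ln (place_abs \<zeta> w (value_at P (character \<zeta> m)))"
      have "pairing (2 * r - s, 2 * s - r) n =
        - (of_int (2 * r - s) * ?l1 + of_int (2 * s - r) * ?l2) / 3" for r s
      proof -
        have "(2 * r - s, 2 * s - r) \<in> char_lattice" by (auto simp: char_lattice_def)
        from bspec[OF n this] show ?thesis
          unfolding log_abs_def[symmetric] val by (simp only: minus_divide_left)
      qed
      from this[of 1 0] this[of 0 1] show "n = (- ?l1 / 3, - ?l2 / 3)"
        by (simp add: pairing_def prod_eq_iff)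
    qed
  qed
  have local_height_eq: "local_height \<zeta> P w = exp (max 0 (max (log_abs w (y1 ^ 3)) (log_abs w (y2 ^ 3))) / 6)"
    if "w \<in> places \<zeta>" for w
  proof -
    have "- phi0 (log_point \<zeta> w P) = max 0 (max (log_abs w (y1 ^ 3)) (log_abs w (y2 ^ 3))) / 3"
      unfolding phi0_eq log_point[OF that] by (auto simp: min_def max_def)
    then show ?thesis by (simp add: local_height_def powr_def)
  qed
  have finite_place: "local_height \<zeta> P (Finite v) = 1" if v: "v \<in> normalized_valuations \<zeta>" for v
  proof -
    have "log_abs (Finite v) z \<le> 0" if z: "z = y1 ^ 3 \<or> z = y2 ^ 3" for z
    proof -
      have "z * z = (y1 ^ 3 + y2 ^ 3) * z - y1 ^ 3 * y2 ^ 3" using z by (auto simp: algebra_simps)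
      then have "z * z = of_int (2 - 9 * a - 27 * b) * z + of_int (- (N ^ 3))"
        unfolding w_sum w_prod by simp
      from valuation_integral_nonneg[OF v _ _ this] have "0 \<le> v z"
        using z ne E N by auto
      moreover have "log_abs (Finite v) z = - of_int (v z) * ln (real (residue_card \<zeta> v))"
        using z ne by (auto simp: log_abs_def ln_of_nat_powi)
      moreover have "0 \<le> ln (real (residue_card \<zeta> v))"
        by (cases "residue_card \<zeta> v = 0") simp_all
      ultimately show ?thesis by simp
    qed
    then show ?thesis using local_height_eq[of "Finite v"] v by (simp add: places_def)
  qed
  have infinite_place: "local_height \<zeta> P Infinite = sqrt (of_int N)"
  proof -
    have eq: "cmod (y2 ^ 3) = cmod (y1 ^ 3)" unfolding cnj[symmetric] by (rule complex_mod_cnj)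
    have "(cmod (y1 ^ 3))\<^sup>2 = cmod (y1 ^ 3 * y2 ^ 3)"
      by (simp only: norm_mult eq power2_eq_square)
    also have "\<dots> = of_int N ^ 3" unfolding w_prod using N by (simp add: norm_power)
    finally have "log_abs Infinite (y1 ^ 3) = 3 * ln (of_int N)" "log_abs Infinite (y2 ^ 3) = 3 * ln (of_int N)"
      using N eq by (simp_all add: log_abs_def ln_realpow del: norm_power)
    moreover have "0 \<le> ln (real_of_int N)" using N by simp
    ultimately have "local_height \<zeta> P Infinite = exp (ln (of_int N) / 2)"
      using local_height_eq[of Infinite] by (simp add: places_def)
    also have "\<dots> = sqrt (of_int N)" using N by (simp add: powr_half_sqrt[symmetric] powr_def)
    finally show ?thesis .
  qed
  have "{w \<in> places \<zeta>. local_height \<zeta> P w \<noteq> 1} = (if local_height \<zeta> P Infinite = 1 then {} else {Infinite})"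
    using finite_place by (auto simp: places_def)
  then have "D0_height \<zeta> P = local_height \<zeta> P Infinite"
    unfolding D0_height_def by simp
  also note infinite_place
  finally show ?thesis by (simp add: P_def N_def)
qed

end

theorem proposition3:
  fixes sc :: "rat \<Rightarrow> 'k::comm_ring_1 \<Rightarrow> 'k"
    and \<sigma> :: "'k \<Rightarrow> 'k" and x :: 'k and \<zeta> :: complex
  assumes "\<zeta> ^ 3 = 1" and "\<zeta> \<noteq> 1"
    and "C3_algebra sc \<sigma>"
    and "normal_element sc \<sigma> x"
    and "C3_trace \<sigma> x = 1"
  shows "\<exists>a b :: rat.
    alg_char_poly sc x = [:b, a, -1, 1:] \<and>
    ((a \<in> \<int> \<and> b \<in> \<int>) \<longleftrightarrow> D0_integral (torus_point sc \<sigma> x)) \<and>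
    (D0_integral (torus_point sc \<sigma> x) \<longrightarrow>
       D0_height \<zeta> (torus_point sc \<sigma> x) = poly_height (alg_char_poly sc x) \<and>
       poly_height (alg_char_poly sc x) = sqrt (1 - 3 * of_rat a))"
proof -
  interpret primitive_cube_root \<zeta> using assms(1,2) by unfold_locales
  have alg: "rat_algebra sc" using assms(3) by (simp add: C3_algebra_def)
  have ex: "normal_cubic_algebra sc \<sigma> x \<and> (\<exists>\<tau>. rat_alg_hom sc (\<lambda>q z. of_rat q * z :: complex) \<tau>)"
  proof (cases "split_cubic sc \<sigma>")
    case True
    then show ?thesis using split_cubic_normal_cubic_algebra alg assms(4,5) by blast
  next
    case False
    then have field: "cubic_abelian_field sc \<sigma>" using assms(3) by (simp add: C3_algebra_def)
    have K: "normal_cubic_algebra sc \<sigma> x"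
      by (rule cubic_abelian_field_normal_cubic_algebra[OF field alg assms(4,5)])
    then show ?thesis
      using normal_cubic_algebra.complex_embedding_of_field[OF K] field
      unfolding cubic_abelian_field_def by blast
  qed
  define \<tau> :: "'k \<Rightarrow> complex" where "\<tau> = (SOME \<tau>. rat_alg_hom sc (\<lambda>q z. of_rat q * z) \<tau>)"
  interpret K: normal_cubic_algebra sc \<sigma> x using ex ..
  have "rat_alg_hom sc (\<lambda>q z. of_rat q * z) \<tau>"
    using someI_ex[OF conjunct2[OF ex]] unfolding \<tau>_def .
  then interpret K: embedded_normal_cubic_algebra sc \<sigma> x \<tau> by unfold_locales
  let ?a = "K.coeff_a" and ?b = "K.coeff_b"
  have P: "torus_point sc \<sigma> x = C3_orbit (\<tau> x, \<tau> (\<sigma> (\<sigma> x)), \<tau> (\<sigma> x))"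
    unfolding torus_point_def Let_def \<tau>_def ..
  have height: "poly_height (alg_char_poly sc x) = sqrt (1 - 3 * of_rat ?a)"
    by (simp add: poly_height_def K.alg_char_poly_eq)
  have "D0_height \<zeta> (torus_point sc \<sigma> x) = sqrt (1 - 3 * of_rat ?a)"
    if "D0_integral (torus_point sc \<sigma> x)"
  proof -
    have "?a \<in> \<int>" "?b \<in> \<int>" using that unfolding P K.D0_integral_iff_coeffs by simp_all
    then obtain a b where ab: "?a = of_int a" "?b = of_int b" by (elim Ints_cases)
    obtain A B C where ABC:
      "K.\<iota> A = x^3 + (\<sigma> (\<sigma> x))^3 + (\<sigma> x)^3 + 6 * x * \<sigma> (\<sigma> x) * \<sigma> x"
      "K.\<iota> B = 3 * (x^2 * \<sigma> (\<sigma> x) + (\<sigma> (\<sigma> x))^2 * \<sigma> x + (\<sigma> x)^2 * x)"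
      "K.\<iota> C = 3 * (x * (\<sigma> (\<sigma> x))^2 + \<sigma> (\<sigma> x) * (\<sigma> x)^2 + \<sigma> x * x^2)"
      using K.resolvent_cube_rational .
    have "D0_height \<zeta> (C3_orbit (\<tau> x, \<tau> (\<sigma> (\<sigma> x)), \<tau> (\<sigma> x))) = sqrt (1 - 3 * of_int a)"
    proof (rule D0_height_orbit)
      show "\<tau> x + \<tau> (\<sigma> (\<sigma> x)) + \<tau> (\<sigma> x) = 1"
        using K.conjugates_sum by (simp add: add_ac)
      show "\<tau> x * \<tau> (\<sigma> (\<sigma> x)) + \<tau> (\<sigma> (\<sigma> x)) * \<tau> (\<sigma> x) + \<tau> (\<sigma> x) * \<tau> x = of_int a"
        using K.conjugates_sum2 by (simp add: ab ac_simps)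
      show "\<tau> x * \<tau> (\<sigma> (\<sigma> x)) * \<tau> (\<sigma> x) = - of_int b"
        using K.conjugates_prod by (simp add: ab ac_simps)
      have "rat_of_int (1 - 3 * a) > 0" using K.one_minus_three_a_positive by (simp add: ab)
      then show "1 - 3 * a > 0" by (simp only: of_int_0_less_iff)
    qed (use ABC[THEN arg_cong[of _ _ \<tau>], symmetric] in simp_all)
    then show ?thesis by (simp add: P ab)
  qed
  then show ?thesis
    using K.alg_char_poly_eq K.D0_integral_iff_coeffs height unfolding P[symmetric]
    by (intro exI[of _ ?a] exI[of _ ?b]) simp
qed

end
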